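(* (Discrete multisymplectic form formula.) Let $L:J^1Y\to\mathbb{R}$ be a smooth discrete Lagrangian, let $U\subseteq X=\mathbb{Z}\times\mathbb{Z}$ be finite and regular, and let $\phi\in\mathcal{C}_U$ be a solution of the discrete Euler–Lagrange field equations on $U$. If $V$ and $W$ are first variations at $\phi$, then $$\sum_{\Delta\subseteq U;\ \Delta\cap\partial U\neq\emptyset}\ \left(\sum_{l;\ \Delta^l\in\partial U}\left[(j^1\phi)^*\bigl(j^1V\lrcorner\, j^1W\lrcorner\,\Omega_L^l\bigr)\right](\Delta)\right)=0 .$$
   Context: $X=\mathbb{Z}\times\mathbb{Z}$, $\mathsf{F}$ is a smooth manifold and $Y=X\times\mathsf{F}$, with fibers $Y_{ij}$. A triangle is an ordered triple $\Delta=((i,j),(i,j+1),(i+1,j+1))$ with first, second, third vertices $\Delta^1,\Delta^2,\Delta^3$; the same symbol denotes its set of vertices; $X^\Delta$ is the set of all triangles. A triangle touches a point if the point is one of its vertices. For $U\subseteq X$: $(i,j)\in U$ is an interior point if $U$ contains all three triangles touching $(i,j)$; $\operatorname{int}U$ is the set of interior points; $\operatorname{cl}U$ is the union of all triangles touching interior points of $U$; $\partial U=(U\cap\operatorname{cl}U)\setminus\operatorname{int}U$; $U$ is regular if $U=\operatorname{int}U\cup\partial U$. The discrete first jet bundle is $J^1Y=X^\Delta\times\mathsf{F}^3$. $\mathcal{C}_U$ is the manifold of sections $\phi:U\to Y$ (i.e. assignments $(i,j)\mapsto y_{ij}\in\mathsf{F}$); $j^1\phi(\Delta)=(\Delta,\phi(\Delta^1),\phi(\Delta^2),\phi(\Delta^3))$.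 Given $L$, put $L_\Delta(y^1,y^2,y^3)=L(\Delta,y^1,y^2,y^3)$; the action is $S(\phi)=\sum_{\Delta\subseteq U}L(j^1\phi(\Delta))$. The discrete Euler–Lagrange field (DELF) equations are: for all $(i,j)\in\operatorname{int}U$, $$\sum_{(\Delta,l):\,\Delta^l=(i,j)}\frac{\partial L_\Delta}{\partial y^l}(y_{\Delta^1},y_{\Delta^2},y_{\Delta^3})=0 .$$ A first variation at a solution $\phi$ is a vertical vector field $V$ on $Y$ (a vector field $V_{ij}$ on each fiber $Y_{ij}\cong\mathsf{F}$) whose flow, acting on sections by $(F^V_\epsilon\phi)(i,j)=F^{V_{ij}}_\epsilon(\phi(i,j))$, maps $\phi$ to other solutions of the DELF equations. Its jet extension is the vector field on $J^1Y$ given by $j^1V(y_{\Delta^1},y_{\Delta^2},y_{\Delta^3})=(V_{\Delta^1}(y_{\Delta^1}),V_{\Delta^2}(y_{\Delta^2}),V_{\Delta^3}(y_{\Delta^3}))$. For $l=1,2,3$, $\Theta_L^l$ is the one-form on $J^1Y$ given on the component $\{\Delta\}\times\mathsf{F}^3$ by $$\Theta_L^l(y_{\Delta^1},y_{\Delta^2},y_{\Delta^3})\cdot(v_1,v_2,v_3)=\frac{\partial L_\Delta}{\partial y^l}(y_{\Delta^1},y_{\Delta^2},y_{\Delta^3})\cdot v_l ,$$ and $\Omega_L^l=-d\Theta_L^l$. The symbol $\lrcorner$ denotes interior product, and $[(j^1\phi)^*f](\Delta)=f(j^1\phi(\Delta))$ for functions $f$ on $J^1Y$. *)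

theory Defs
  imports "HOL-Analysis.Analysis"
begin

section \<open>Smooth functions on open subsets of finite-dimensional normed spaces\<close>

text \<open>
  Class \<open>C\<^sup>n\<close> on an open set \<open>S\<close>, through iterated directional derivatives. Over a
  finite-dimensional domain (the only use below) this is the usual notion.
\<close>

primrec differentiable_times ::
    "nat \<Rightarrow> 'a::real_normed_vector set \<Rightarrow> ('a \<Rightarrow> 'b::real_normed_vector) \<Rightarrow> bool" where
  "differentiable_times 0 S f \<longleftrightarrow> continuous_on S f"
| "differentiable_times (Suc n) S f \<longleftrightarrow>
     (\<forall>x\<in>S. f differentiable (at x)) \<and>
     (\<forall>v. differentiable_times n S (\<lambda>x. frechet_derivative f (at x) v))"

definition smooth_on ::
    "'a::real_normed_vector set \<Rightarrow> ('a \<Rightarrow> 'b::real_normed_vector) \<Rightarrow> bool" where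
  "smooth_on S f \<longleftrightarrow> (\<forall>n. differentiable_times n S f)"


section \<open>Smooth manifolds\<close>

type_synonym ('m, 'e) chart = "'m set \<times> ('m \<Rightarrow> 'e)"

abbreviation cdom :: "('m, 'e) chart \<Rightarrow> 'm set" where "cdom k \<equiv> fst k"
abbreviation cmap :: "('m, 'e) chart \<Rightarrow> 'm \<Rightarrow> 'e" where "cmap k \<equiv> snd k"

definition cinv :: "('m, 'e) chart \<Rightarrow> 'e \<Rightarrow> 'm" where
  "cinv k = inv_into (cdom k) (cmap k)"

text \<open>
  Besides its topology and atlas, a manifold carries for every point a preferred chart around it.
  The tangent space at \<open>p\<close> is the model space \<open>'e\<close>: the vector \<open>v::'e\<close> at \<open>p\<close> stands for the
  tangent vector whose components in the chart \<open>chart_at M p\<close> are \<open>v\<close>. (The choice of preferred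
  charts is no extra structure: another choice only changes the names of tangent vectors.)
\<close>

record ('m, 'e) manifold =
  mtop :: "'m topology"
  atlas :: "('m, 'e) chart set"
  chart_at :: "'m \<Rightarrow> ('m, 'e) chart"

abbreviation points :: "('m, 'e) manifold \<Rightarrow> 'm set" where
  "points M \<equiv> topspace (mtop M)"

text \<open>
  The sort of the model space says that it is a finite-dimensional real normed space (bounded
  closed sets are compact). Unlike \<open>euclidean_space\<close>, it does not exclude dimension 0.
\<close>

definition smooth_manifold :: "('m, 'e::{banach,heine_borel}) manifold \<Rightarrow> bool" where
  "smooth_manifold M \<longleftrightarrow>
     Hausdorff_space (mtop M) \<and> second_countable (mtop M) \<and>
     (\<forall>k\<in>atlas M. openin (mtop M) (cdom k) \<and> open (cmap k ` cdom k) \<and>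
        homeomorphic_map (subtopology (mtop M) (cdom k)) (top_of_set (cmap k ` cdom k)) (cmap k)) \<and>
     (\<forall>k\<in>atlas M. \<forall>k'\<in>atlas M.
        smooth_on (cmap k ` (cdom k \<inter> cdom k')) (cmap k' \<circ> cinv k)) \<and>
     (\<forall>p\<in>points M. chart_at M p \<in> atlas M \<and> p \<in> cdom (chart_at M p))"

definition prod_manifold ::
    "('m, 'e) manifold \<Rightarrow> ('n, 'f) manifold \<Rightarrow> ('m \<times> 'n, 'e \<times> 'f) manifold" where
  "prod_manifold M N =
     \<lparr> mtop = prod_topology (mtop M) (mtop N),
       atlas = {(cdom k \<times> cdom k', map_prod (cmap k) (cmap k')) |k k'. k \<in> atlas M \<and> k' \<in> atlas N},
       chart_at = (\<lambda>(p, q). (cdom (chart_at M p) \<times> cdom (chart_at N q),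
                             map_prod (cmap (chart_at M p)) (cmap (chart_at N q)))) \<rparr>"

text \<open>The product \<open>I \<times> M\<close> with a discrete set \<open>I\<close>, i.e. a disjoint union of copies of \<open>M\<close>.\<close>

definition copies :: "'i set \<Rightarrow> ('m, 'e) manifold \<Rightarrow> ('i \<times> 'm, 'e) manifold" where
  "copies I M =
     \<lparr> mtop = prod_topology (discrete_topology I) (mtop M),
       atlas = {({i} \<times> cdom k, cmap k \<circ> snd) |i k. i \<in> I \<and> k \<in> atlas M},
       chart_at = (\<lambda>(i, p). ({i} \<times> cdom (chart_at M p), cmap (chart_at M p) \<circ> snd)) \<rparr>"


section \<open>Calculus on manifolds\<close>

definition smooth_function ::
    "('m, 'e::real_normed_vector) manifold \<Rightarrow> ('m \<Rightarrow> real) \<Rightarrow> bool" where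
  "smooth_function M f \<longleftrightarrow> (\<forall>k\<in>atlas M. smooth_on (cmap k ` cdom k) (f \<circ> cinv k))"

definition differential ::
    "('m, 'e::real_normed_vector) manifold \<Rightarrow> ('m \<Rightarrow> real) \<Rightarrow> 'm \<Rightarrow> 'e \<Rightarrow> real" where
  "differential M f p v =
     (let k = chart_at M p in frechet_derivative (f \<circ> cinv k) (at (cmap k p)) v)"

text \<open>Turns the components in \<open>k\<close> of a tangent vector at \<open>p\<close> into its components in \<open>k'\<close>.\<close>

definition coord_change ::
    "('m, 'e::real_normed_vector) chart \<Rightarrow> ('m, 'e) chart \<Rightarrow> 'm \<Rightarrow> 'e \<Rightarrow> 'e" where
  "coord_change k k' p v = frechet_derivative (cmap k' \<circ> cinv k) (at (cmap k p)) v"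

definition smooth_vector_field ::
    "('m, 'e::real_normed_vector) manifold \<Rightarrow> ('m \<Rightarrow> 'e) \<Rightarrow> bool" where
  "smooth_vector_field M V \<longleftrightarrow>
     (\<forall>k\<in>atlas M. smooth_on (cmap k ` cdom k)
        ((\<lambda>p. coord_change (chart_at M p) k p (V p)) \<circ> cinv k))"

definition integral_curve ::
    "('m, 'e::real_normed_vector) manifold \<Rightarrow> ('m \<Rightarrow> 'e) \<Rightarrow> real set \<Rightarrow> (real \<Rightarrow> 'm) \<Rightarrow> bool" where
  "integral_curve M V I \<gamma> \<longleftrightarrow>
     continuous_map (top_of_set I) (mtop M) \<gamma> \<and>
     (\<forall>t\<in>I. ((cmap (chart_at M (\<gamma> t)) \<circ> \<gamma>) has_vector_derivative V (\<gamma> t)) (at t))"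

text \<open>
  \<open>flows_to M V \<epsilon> p q\<close> is \<open>F\<^sub>\<epsilon>\<^sup>V(p) = q\<close>. The flow of \<open>V\<close> need not be complete, so
  \<open>F\<^sub>\<epsilon>\<^sup>V\<close> is a partial map, here given by its graph.
\<close>

definition flows_to ::
    "('m, 'e::real_normed_vector) manifold \<Rightarrow> ('m \<Rightarrow> 'e) \<Rightarrow> real \<Rightarrow> 'm \<Rightarrow> 'm \<Rightarrow> bool" where
  "flows_to M V \<epsilon> p q \<longleftrightarrow>
     (\<exists>I \<gamma>. open I \<and> is_interval I \<and> 0 \<in> I \<and> \<epsilon> \<in> I \<and>
        integral_curve M V I \<gamma> \<and> \<gamma> 0 = p \<and> \<gamma> \<epsilon> = q)"

text \<open>
  Differential forms: a one-form has type \<open>'m \<Rightarrow> 'e \<Rightarrow> real\<close>, a two-form \<open>'m \<Rightarrow> 'e \<Rightarrow> 'e \<Rightarrow> real\<close>.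
  \<open>form_in_chart M \<theta> k x\<close> is the coordinate expression of \<open>\<theta>\<close> in the chart \<open>k\<close> at \<open>x\<close>; the
  exterior derivative is \<open>d\<theta>(v, w) = \<partial>\<^sub>v \<theta>(w) - \<partial>\<^sub>w \<theta>(v)\<close> for \<open>v\<close>, \<open>w\<close> constant in coordinates.
\<close>

definition form_in_chart ::
    "('m, 'e::real_normed_vector) manifold \<Rightarrow> ('m \<Rightarrow> 'e \<Rightarrow> real) \<Rightarrow> ('m, 'e) chart \<Rightarrow> 'e \<Rightarrow> 'e \<Rightarrow> real"
  where
  "form_in_chart M \<theta> k x v = (let p = cinv k x in \<theta> p (coord_change k (chart_at M p) p v))"

definition exterior_derivative ::
    "('m, 'e::real_normed_vector) manifold \<Rightarrow> ('m \<Rightarrow> 'e \<Rightarrow> real) \<Rightarrow> 'm \<Rightarrow> 'e \<Rightarrow> 'e \<Rightarrow> real" where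
  "exterior_derivative M \<theta> p v w =
     (let k = chart_at M p in
        frechet_derivative (\<lambda>x. form_in_chart M \<theta> k x w) (at (cmap k p)) v
      - frechet_derivative (\<lambda>x. form_in_chart M \<theta> k x v) (at (cmap k p)) w)"

definition interior_product :: "('m \<Rightarrow> 'e) \<Rightarrow> ('m \<Rightarrow> 'e \<Rightarrow> 'b) \<Rightarrow> 'm \<Rightarrow> 'b" (infixr \<open>\<lrcorner>\<close> 75) where
  "(V \<lrcorner> \<alpha>) p = \<alpha> p (V p)"


section \<open>The discrete space-time\<close>

text \<open>Components of triples are numbered 1, 2, 3.\<close>

definition comp3 :: "'a \<times> 'a \<times> 'a \<Rightarrow> nat \<Rightarrow> 'a" where
  "comp3 t l = (case t of (a, b, c) \<Rightarrow> if l = 1 then a else if l = 2 then b else c)"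

definition upd3 :: "'a \<times> 'a \<times> 'a \<Rightarrow> nat \<Rightarrow> 'a \<Rightarrow> 'a \<times> 'a \<times> 'a" where
  "upd3 t l z =
     (case t of (a, b, c) \<Rightarrow> if l = 1 then (z, b, c) else if l = 2 then (a, z, c) else (a, b, z))"

type_synonym node = "int \<times> int"
type_synonym triangle = "node \<times> node \<times> node"

definition triangles :: "triangle set" where
  "triangles = {((i, j), (i, j + 1), (i + 1, j + 1)) |i j. True}"

definition verts :: "triangle \<Rightarrow> node set" where
  "verts \<Delta> = comp3 \<Delta> ` {1..3}"

definition d_interior :: "node set \<Rightarrow> node set" where
  "d_interior U = {x \<in> U. \<forall>\<Delta>\<in>triangles. x \<in> verts \<Delta> \<longrightarrow> verts \<Delta> \<subseteq> U}"

definition d_closure :: "node set \<Rightarrow> node set" where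
  "d_closure U = \<Union> {verts \<Delta> |\<Delta>. \<Delta> \<in> triangles \<and> verts \<Delta> \<inter> d_interior U \<noteq> {}}"

definition d_boundary :: "node set \<Rightarrow> node set" where
  "d_boundary U = (U \<inter> d_closure U) - d_interior U"

definition d_regular :: "node set \<Rightarrow> bool" where
  "d_regular U \<longleftrightarrow> U = d_interior U \<union> d_boundary U"


section \<open>Discrete field theory with fibre \<open>F\<close>\<close>

definition jet_bundle ::
    "('f, 'e) manifold \<Rightarrow> (triangle \<times> 'f \<times> 'f \<times> 'f, 'e \<times> 'e \<times> 'e) manifold" where
  "jet_bundle F = copies triangles (prod_manifold F (prod_manifold F F))"

definition sections :: "('f, 'e) manifold \<Rightarrow> node set \<Rightarrow> (node \<Rightarrow> 'f) set" where
  "sections F U = U \<rightarrow>\<^sub>E points F"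

definition jet :: "(node \<Rightarrow> 'f) \<Rightarrow> triangle \<Rightarrow> triangle \<times> 'f \<times> 'f \<times> 'f" where
  "jet \<phi> \<Delta> = (\<Delta>, \<phi> (comp3 \<Delta> 1), \<phi> (comp3 \<Delta> 2), \<phi> (comp3 \<Delta> 3))"

definition partial_L ::
    "('f, 'e::real_normed_vector) manifold \<Rightarrow> (triangle \<times> 'f \<times> 'f \<times> 'f \<Rightarrow> real) \<Rightarrow> nat \<Rightarrow>
     triangle \<times> 'f \<times> 'f \<times> 'f \<Rightarrow> 'e \<Rightarrow> real" where
  "partial_L F L l =
     (\<lambda>(\<Delta>, y) v. differential F (\<lambda>z. L (\<Delta>, upd3 y l z)) (comp3 y l) v)"

definition DELF_solution ::
    "('f, 'e::real_normed_vector) manifold \<Rightarrow> (triangle \<times> 'f \<times> 'f \<times> 'f \<Rightarrow> real) \<Rightarrow> node set \<Rightarrow>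
     (node \<Rightarrow> 'f) \<Rightarrow> bool" where
  "DELF_solution F L U \<phi> \<longleftrightarrow>
     \<phi> \<in> sections F U \<and>
     (\<forall>x\<in>d_interior U. \<forall>v.
        (\<Sum>(\<Delta>, l)\<in>{(\<Delta>, l). \<Delta> \<in> triangles \<and> l \<in> {1..3} \<and> comp3 \<Delta> l = x}.
           partial_L F L l (jet \<phi> \<Delta>) v) = 0)"

text \<open>
  As \<open>X\<close> is discrete, a vertical vector field on \<open>Y = X \<times> F\<close> is a family of vector fields on \<open>F\<close>.
  The flow of \<open>V\<close> is applied for all times \<open>\<epsilon>\<close> for which it is defined at \<open>\<phi>\<close>.
\<close>

definition first_variation ::
    "('f, 'e::real_normed_vector) manifold \<Rightarrow> (triangle \<times> 'f \<times> 'f \<times> 'f \<Rightarrow> real) \<Rightarrow> node set \<Rightarrow>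
     (node \<Rightarrow> 'f) \<Rightarrow> (node \<Rightarrow> 'f \<Rightarrow> 'e) \<Rightarrow> bool" where
  "first_variation F L U \<phi> V \<longleftrightarrow>
     (\<forall>x. smooth_vector_field F (V x)) \<and>
     (\<forall>\<epsilon>. \<forall>\<psi>\<in>sections F U. (\<forall>x\<in>U. flows_to F (V x) \<epsilon> (\<phi> x) (\<psi> x)) \<longrightarrow> DELF_solution F L U \<psi>)"

definition jet_ext ::
    "(node \<Rightarrow> 'f \<Rightarrow> 'e) \<Rightarrow> triangle \<times> 'f \<times> 'f \<times> 'f \<Rightarrow> 'e \<times> 'e \<times> 'e" where
  "jet_ext V =
     (\<lambda>(\<Delta>, y1, y2, y3). (V (comp3 \<Delta> 1) y1, V (comp3 \<Delta> 2) y2, V (comp3 \<Delta> 3) y3))"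

definition Theta ::
    "('f, 'e::real_normed_vector) manifold \<Rightarrow> (triangle \<times> 'f \<times> 'f \<times> 'f \<Rightarrow> real) \<Rightarrow> nat \<Rightarrow>
     triangle \<times> 'f \<times> 'f \<times> 'f \<Rightarrow> 'e \<times> 'e \<times> 'e \<Rightarrow> real" where
  "Theta F L l p v = partial_L F L l p (comp3 v l)"

definition Omega ::
    "('f, 'e::real_normed_vector) manifold \<Rightarrow> (triangle \<times> 'f \<times> 'f \<times> 'f \<Rightarrow> real) \<Rightarrow> nat \<Rightarrow>
     triangle \<times> 'f \<times> 'f \<times> 'f \<Rightarrow> 'e \<times> 'e \<times> 'e \<Rightarrow> 'e \<times> 'e \<times> 'e \<Rightarrow> real" where
  "Omega F L l p v w = - exterior_derivative (jet_bundle F) (Theta F L l) p v w"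

definition jet_pullback ::
    "(node \<Rightarrow> 'f) \<Rightarrow> (triangle \<times> 'f \<times> 'f \<times> 'f \<Rightarrow> real) \<Rightarrow> triangle \<Rightarrow> real" where
  "jet_pullback \<phi> f \<Delta> = f (jet \<phi> \<Delta>)"

end

theory Submission
  imports Defs
begin

text \<open>
  Fix a triangle \<open>\<Delta>\<close> inside \<open>U\<close>, write \<open>\<ell>\<close> for \<open>L\<close> on \<open>{\<Delta>} \<times> F \<times> F \<times> F\<close> in the charts preferred at
  the three values of \<open>\<phi>\<close>, and let \<open>H\<close> be the second derivative of \<open>\<ell>\<close> at the point given by \<open>\<phi>\<close>.
  In these coordinates the form \<open>\<Theta>\<^sup>l\<close> is \<open>w \<mapsto> D\<ell>(x)(0, \<dots>, w\<^sub>l, \<dots>, 0)\<close>, so that, with \<open>e\<^sub>l\<close>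
  the inclusion of the \<open>l\<close>-th factor,
  \<open>\<Omega>\<^sup>l(v, w) = H(w, e\<^sub>l v\<^sub>l) - H(v, e\<^sub>l w\<^sub>l)\<close> (\<open>Omega_in_charts\<close>). Two facts follow.

  First, summed over all three vertices of one triangle, \<open>\<Omega>\<^sup>l(v, w)\<close> gives
  \<open>H(w, v) - H(v, w) = 0\<close> (\<open>sum_Omega\<close>); this is \<open>d\<^sup>2L = 0\<close>, i.e. the symmetry of second derivatives.

  Second, summed over the three pairs \<open>(\<Delta>, l)\<close> with \<open>\<Delta>\<^sup>l = x\<close> for an interior point \<open>x\<close>,
  \<open>\<Omega>\<^sup>l(j\<^sup>1W, j\<^sup>1V)\<close> gives \<open>0\<close> (\<open>sum_Omega_at_interior\<close>). Indeed, the flow of \<open>V\<close> carries \<open>\<phi>\<close>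
  through solutions, so the field equation at \<open>x\<close> may be differentiated along it; the result is
  \<open>\<Sum> H\<^sub>\<Delta>(j\<^sup>1V, e\<^sub>l u) = 0\<close> for every vector \<open>u\<close> (\<open>first_variation_linearised\<close>). Take \<open>u = W(\<phi>(x))\<close>,
  exchange \<open>V\<close> and \<open>W\<close>, and subtract.

  Every vertex of a triangle inside a regular \<open>U\<close> is either interior or on the boundary.
  By the first fact the sum over all vertices of all triangles inside \<open>U\<close> vanishes, and by the second
  one so does the part of it that belongs to interior vertices, since every triangle
  touching an interior point lies inside \<open>U\<close>. What remains is the sum over boundary vertices.

  Differentiating along the flow requires that the flow exists for small times at each of the
  finitely many points of \<open>U\<close>. This is the Picard-Lindeloef theorem, which is proved here for
  smooth autonomous equations (\<open>picard_lindelof_autonomous\<close>) and transported to manifolds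
  (\<open>local_flow\<close>).
\<close>

section \<open>Symmetry of second derivatives\<close>

text \<open>
  The second difference over a parallelogram is a mean value of one of the mixed
  second derivatives: the mean value theorem is applied first in direction \<open>v\<close>, to the
  difference of \<open>f\<close> along two opposite sides, and then in direction \<open>w\<close>.
\<close>

lemma mixed_difference_mvt:
  fixes f :: "'a::real_normed_vector \<Rightarrow> real"
  assumes h: "h > 0"
    and f: "\<And>s t. s \<in> {0..h} \<Longrightarrow> t \<in> {0..h} \<Longrightarrow> f differentiable (at (x + s *\<^sub>R v + t *\<^sub>R w))"
    and f': "\<And>s t. s \<in> {0..h} \<Longrightarrow> t \<in> {0..h} \<Longrightarrow>
               (\<lambda>y. frechet_derivative f (at y) v) differentiable (at (x + s *\<^sub>R v + t *\<^sub>R w))"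
  shows "\<exists>s\<in>{0..h}. \<exists>t\<in>{0..h}.
           f (x + h *\<^sub>R v + h *\<^sub>R w) - f (x + h *\<^sub>R v) - f (x + h *\<^sub>R w) + f x =
           h * h * frechet_derivative (\<lambda>y. frechet_derivative f (at y) v)
                     (at (x + s *\<^sub>R v + t *\<^sub>R w)) w"
proof -
  have line: "((\<lambda>s. g (a + s *\<^sub>R b)) has_real_derivative frechet_derivative g (at (a + s *\<^sub>R b)) b) (at s)"
    if "g differentiable (at (a + s *\<^sub>R b))" for g :: "'a \<Rightarrow> real" and a b s
  proof -
    have "((\<lambda>s. a + s *\<^sub>R b) has_derivative (\<lambda>s. s *\<^sub>R b)) (at s)"
      by (auto intro!: derivative_eq_intros)
    from has_derivative_compose[OF this that[unfolded frechet_derivative_works]]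
    have "((\<lambda>s. g (a + s *\<^sub>R b)) has_derivative
            (\<lambda>r. frechet_derivative g (at (a + s *\<^sub>R b)) (r *\<^sub>R b))) (at s)" .
    then show ?thesis
      unfolding has_field_derivative_def
      by (simp add: linear_cmul[OF linear_frechet_derivative[OF that]] mult.commute[of _ "frechet_derivative _ _ _"])
  qed
  let ?d = "\<lambda>y. frechet_derivative f (at y) v"
  define g where "g = (\<lambda>s. f ((x + h *\<^sub>R w) + s *\<^sub>R v) - f (x + s *\<^sub>R v))"
  have "\<exists>s. 0 < s \<and> s < h \<and> g h - g 0 = (h - 0) * (?d ((x + h *\<^sub>R w) + s *\<^sub>R v) - ?d (x + s *\<^sub>R v))"
    unfolding g_def
  proof (rule MVT2[OF h])
    fix s assume s: "0 \<le> s" "s \<le> h"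
    show "((\<lambda>s. f ((x + h *\<^sub>R w) + s *\<^sub>R v) - f (x + s *\<^sub>R v)) has_real_derivative
             ?d ((x + h *\<^sub>R w) + s *\<^sub>R v) - ?d (x + s *\<^sub>R v)) (at s)"
      using f[of s h] f[of s 0] s h by (intro DERIV_diff line) (auto simp: algebra_simps)
  qed
  then obtain s where s: "0 < s" "s < h"
    and gs: "g h - g 0 = h * (?d ((x + h *\<^sub>R w) + s *\<^sub>R v) - ?d (x + s *\<^sub>R v))"
    by auto
  have "\<exists>t. 0 < t \<and> t < h \<and> ?d ((x + s *\<^sub>R v) + h *\<^sub>R w) - ?d ((x + s *\<^sub>R v) + 0 *\<^sub>R w)
          = (h - 0) * frechet_derivative ?d (at ((x + s *\<^sub>R v) + t *\<^sub>R w)) w"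
    using s by (intro MVT2[OF h] line f') auto
  then obtain t where t: "0 < t" "t < h"
    and "?d (x + s *\<^sub>R v + h *\<^sub>R w) - ?d (x + s *\<^sub>R v)
          = h * frechet_derivative ?d (at (x + s *\<^sub>R v + t *\<^sub>R w)) w"
    by auto
  then have "g h - g 0 = h * h * frechet_derivative ?d (at (x + s *\<^sub>R v + t *\<^sub>R w)) w"
    using gs by (simp add: algebra_simps)
  then show ?thesis
    using s t by (intro bexI[of _ s] bexI[of _ t]) (auto simp: g_def algebra_simps)
qed

text \<open>
  The second difference in \<open>mixed_difference_mvt\<close> does not change when \<open>v\<close> and \<open>w\<close> are exchanged, so
  arbitrarily near to \<open>x\<close> there are two points, one for each mixed derivative, at which they have the
  same value, and both are continuous at \<open>x\<close>.
\<close>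

lemma symmetric_second_derivative:
  fixes f :: "'a::real_normed_vector \<Rightarrow> real"
  assumes S: "open S" "x \<in> S" and f: "smooth_on S f"
  shows "frechet_derivative (\<lambda>y. frechet_derivative f (at y) v) (at x) w =
         frechet_derivative (\<lambda>y. frechet_derivative f (at y) w) (at x) v"
proof (rule ccontr)
  define A where
    "A = (\<lambda>v w y. frechet_derivative (\<lambda>y. frechet_derivative f (at y) v) (at y) w)"
  have C2: "differentiable_times (Suc (Suc 0)) S f"
    using f unfolding smooth_on_def by blast
  have cont: "isCont (A v w) x" for v w
    using C2 S unfolding A_def by (auto simp: continuous_on_eq_continuous_at)
  assume "\<not> ?thesis"
  then have e: "\<bar>A v w x - A w v x\<bar> / 2 > 0" (is "?e > 0")
    by (simp add: A_def)
  obtain d1 where d1: "d1 > 0" "\<And>y. dist y x < d1 \<Longrightarrow> dist (A v w y) (A v w x) < ?e"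
    using cont[of v w] e unfolding continuous_at_eps_delta by metis
  obtain d2 where d2: "d2 > 0" "\<And>y. dist y x < d2 \<Longrightarrow> dist (A w v y) (A w v x) < ?e"
    using cont[of w v] e unfolding continuous_at_eps_delta by metis
  obtain d3 where d3: "d3 > 0" "ball x d3 \<subseteq> S"
    using S openE by blast
  define d where "d = min d1 (min d2 d3)"
  have d: "d > 0" using d1 d2 d3 by (simp add: d_def)
  \<comment> \<open>Small enough for the whole parallelogram with sides \<open>h v\<close> and \<open>h w\<close> to stay within \<open>d\<close> of \<open>x\<close>.\<close>
  define h where "h = d / (norm v + norm w + 1)"
  have n: "norm v + norm w + 1 > 0" by (smt (verit) norm_ge_zero)
  have h: "h > 0" using d n by (simp add: h_def)
  have near: "dist (x + s *\<^sub>R v + t *\<^sub>R w) x < d" if "s \<in> {0..h}" "t \<in> {0..h}" for s t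
  proof -
    have "norm (s *\<^sub>R v + t *\<^sub>R w) \<le> s * norm v + t * norm w"
      using that by (intro order.trans[OF norm_triangle_ineq]) auto
    also have "\<dots> \<le> h * norm v + h * norm w"
      using that by (intro add_mono mult_right_mono) auto
    also have "\<dots> < h * (norm v + norm w + 1)" using h by (simp add: algebra_simps)
    also have "\<dots> = d" using n by (simp add: h_def)
    finally show ?thesis by (simp add: dist_norm add.assoc)
  qed
  have near': "dist (x + s *\<^sub>R w + t *\<^sub>R v) x < d" if "s \<in> {0..h}" "t \<in> {0..h}" for s t
    using near[OF that(2,1)] by (simp add: algebra_simps)
  have inS: "y \<in> S" if "dist y x < d" for y
    using that d3 by (auto simp: d_def dist_commute)
  have diff1: "f differentiable (at y)" if "dist y x < d" for y
    using C2 inS[OF that] by auto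
  have diff2: "(\<lambda>z. frechet_derivative f (at z) u) differentiable (at y)" if "dist y x < d" for y u
    using C2 inS[OF that] by auto
  obtain s t where st: "s \<in> {0..h}" "t \<in> {0..h}"
    "f (x + h *\<^sub>R v + h *\<^sub>R w) - f (x + h *\<^sub>R v) - f (x + h *\<^sub>R w) + f x
       = h * h * A v w (x + s *\<^sub>R v + t *\<^sub>R w)"
    using mixed_difference_mvt[OF h, of f x v w] diff1[OF near] diff2[OF near] unfolding A_def by blast
  obtain s' t' where st': "s' \<in> {0..h}" "t' \<in> {0..h}"
    "f (x + h *\<^sub>R w + h *\<^sub>R v) - f (x + h *\<^sub>R w) - f (x + h *\<^sub>R v) + f x
       = h * h * A w v (x + s' *\<^sub>R w + t' *\<^sub>R v)"
    using mixed_difference_mvt[OF h, of f x w v] diff1[OF near'] diff2[OF near'] unfolding A_def by blast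
  have "h * h * A v w (x + s *\<^sub>R v + t *\<^sub>R w) = h * h * A w v (x + s' *\<^sub>R w + t' *\<^sub>R v)"
    unfolding st(3)[symmetric] st'(3)[symmetric] by (simp add: algebra_simps)
  then have "A v w (x + s *\<^sub>R v + t *\<^sub>R w) = A w v (x + s' *\<^sub>R w + t' *\<^sub>R v)"
    using h by simp
  moreover have "dist (A v w (x + s *\<^sub>R v + t *\<^sub>R w)) (A v w x) < ?e"
    using near[OF st(1,2)] by (intro d1) (auto simp: d_def)
  moreover have "dist (A w v (x + s' *\<^sub>R w + t' *\<^sub>R v)) (A w v x) < ?e"
    using near'[OF st'(1,2)] by (intro d2) (auto simp: d_def)
  ultimately show False
    unfolding dist_real_def by argo
qed

section \<open>Local solutions of ordinary differential equations\<close>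

text \<open>
  The argument is the usual one with Baire's theorem. It replaces the use of a basis: the model
  space of a manifold is known to be finite-dimensional only through the compactness of its
  bounded closed sets.
\<close>

lemma uniform_boundedness:
  fixes f :: "'i \<Rightarrow> 'a::{real_normed_vector,heine_borel} \<Rightarrow> 'b::real_normed_vector"
  assumes lin: "\<And>i. i \<in> I \<Longrightarrow> bounded_linear (f i)"
    and bdd: "\<And>v. \<exists>B. \<forall>i\<in>I. norm (f i v) \<le> B"
  shows "\<exists>B\<ge>0. \<forall>i\<in>I. \<forall>v. norm (f i v) \<le> B * norm v"
proof -
  define C where "C = (\<lambda>n::nat. {v. \<forall>i\<in>I. norm (f i v) \<le> real n})"
  have closed: "closed (C n)" for n
  proof -
    have "C n = (\<Inter>i\<in>I. {v. norm (f i v) \<le> real n})" by (auto simp: C_def)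
    moreover have "closed {v. norm (f i v) \<le> real n}" if "i \<in> I" for i
      using lin[OF that]
      by (intro closed_Collect_le continuous_intros linear_continuous_on)
    ultimately show ?thesis by auto
  qed
  have "\<exists>n. interior (C n) \<noteq> {}"
  proof (rule ccontr)
    assume "\<nexists>n. interior (C n) \<noteq> {}"
    then have "(UNIV :: 'a set) \<subseteq> closure (\<Inter> (range (\<lambda>n. - C n)))"
      using closed by (intro Baire) (auto simp: closure_complement)
    moreover have "\<Inter> (range (\<lambda>n. - C n)) = {}"
    proof -
      have "\<exists>n. v \<in> C n" for v
      proof -
        obtain B where B: "\<forall>i\<in>I. norm (f i v) \<le> B" using bdd by blast
        obtain n where "B \<le> real n" using real_arch_simple by blast
        with B have "v \<in> C n" by (force simp: C_def)
        then show ?thesis ..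
      qed
      then show ?thesis by auto
    qed
    ultimately show False by simp
  qed
  then obtain n v0 where "v0 \<in> interior (C n)" by blast
  then obtain r where r: "r > 0" "cball v0 r \<subseteq> C n"
    by (meson interior_subset open_contains_cball open_interior subset_trans)
  have "norm (f i v) \<le> (2 * n / r) * norm v" if i: "i \<in> I" for i v
  proof (cases "v = 0")
    case True
    then show ?thesis using lin[OF i] by (simp add: linear_simps)
  next
    case False
    define u where "u = (r / norm v) *\<^sub>R v"
    have "v0 + u \<in> cball v0 r" "v0 \<in> cball v0 r"
      using r False by (auto simp: u_def dist_norm)
    then have "norm (f i (v0 + u)) \<le> n" "norm (f i v0) \<le> n"
      using r(2) i unfolding C_def by blast+
    then have "norm (f i u) \<le> 2 * n"
      using norm_triangle_ineq4[of "f i (v0 + u)" "f i v0"] lin[OF i]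
      by (simp add: linear_simps)
    moreover have "norm (f i u) = (r / norm v) * norm (f i v)"
      using lin[OF i] r by (simp add: u_def linear_simps)
    ultimately show ?thesis using r False by (simp add: field_simps)
  qed
  then show ?thesis using r by (intro exI[of _ "2 * n / r"]) auto
qed

text \<open>
  Smoothness only bounds each directional derivative on a compact ball; by
  \<open>uniform_boundedness\<close> this bounds the operator norm of the derivative.
\<close>

lemma smooth_on_imp_lipschitz_on_cball:
  fixes X :: "'a::{real_normed_vector,heine_borel} \<Rightarrow> 'b::real_normed_vector"
  assumes "open S" "x \<in> S" and X: "smooth_on S X"
  obtains r B where "r > 0" "cball x r \<subseteq> S" "B-lipschitz_on (cball x r) X"
proof -
  obtain r where r: "r > 0" "cball x r \<subseteq> S"
    using assms open_contains_cball by blast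
  have C1: "differentiable_times (Suc 0) S X"
    using X unfolding smooth_on_def by blast
  then have der: "(X has_derivative frechet_derivative X (at y)) (at y)" if "y \<in> cball x r" for y
    using that r frechet_derivative_works[of X "at y"] by auto
  have bdd: "\<exists>B. \<forall>y\<in>cball x r. norm (frechet_derivative X (at y) v) \<le> B" for v
  proof -
    have "continuous_on (cball x r) (\<lambda>y. frechet_derivative X (at y) v)"
      using C1 r by (auto intro: continuous_on_subset)
    then have "bounded ((\<lambda>y. frechet_derivative X (at y) v) ` cball x r)"
      by (intro compact_imp_bounded compact_continuous_image) auto
    then show ?thesis by (auto simp: bounded_iff)
  qed
  have "\<exists>B\<ge>0. \<forall>y\<in>cball x r. \<forall>v. norm (frechet_derivative X (at y) v) \<le> B * norm v"
    using has_derivative_bounded_linear[OF der] bdd by (rule uniform_boundedness)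
  then obtain B where B: "B \<ge> 0"
    "\<And>y v. y \<in> cball x r \<Longrightarrow> norm (frechet_derivative X (at y) v) \<le> B * norm v"
    by blast
  have "B-lipschitz_on (cball x r) X"
  proof (rule bounded_derivative_imp_lipschitz)
    show "(X has_derivative frechet_derivative X (at y)) (at y within cball x r)"
      if "y \<in> cball x r" for y
      using der[OF that] by (rule has_derivative_at_withinI)
    show "onorm (frechet_derivative X (at y)) \<le> B" if "y \<in> cball x r" for y
      using B(1) B(2)[OF that] by (rule onorm_bound)
  qed (use B in auto)
  with r show ?thesis using that by blast
qed

text \<open>
  The solution is the fixed point of \<open>c \<mapsto> x0 + \<integral>\<^sub>0\<^sup>t X(c)\<close> among the bounded continuous curves in the ball.
  In order to work with curves on the whole real line, time is clamped to \<open>[-\<delta>, \<delta>]\<close>.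
\<close>

lemma picard_lindelof_autonomous:
  fixes X :: "'a::banach \<Rightarrow> 'a"
  assumes r: "r > 0" and lip: "B-lipschitz_on (cball x0 r) X"
  obtains \<delta> c where "\<delta> > 0" "c 0 = x0"
    "\<And>t. \<bar>t\<bar> < \<delta> \<Longrightarrow> c t \<in> cball x0 r"
    "\<And>t. \<bar>t\<bar> < \<delta> \<Longrightarrow> (c has_vector_derivative X (c t)) (at t)"
proof -
  have B: "B \<ge> 0" using lip lipschitz_on_nonneg by blast
  define M where "M = norm (X x0) + B * r"
  have M: "norm (X y) \<le> M" if "y \<in> cball x0 r" for y
  proof -
    have "norm (X y - X x0) \<le> B * norm (y - x0)"
      using lipschitz_onD[OF lip that, of x0] r by (simp add: dist_norm)
    also have "\<dots> \<le> B * r"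
      using that B by (intro mult_left_mono) (auto simp: dist_norm norm_minus_commute)
    finally show ?thesis unfolding M_def by (smt (verit) norm_triangle_sub)
  qed
  have M0: "M \<ge> 0" using B r by (simp add: M_def)
  \<comment> \<open>The first bound keeps the curves in the ball, the second makes the map a contraction.\<close>
  define \<delta> where "\<delta> = min (r / (M + 1)) (1 / (2 * (B + 1)))"
  have \<delta>: "\<delta> > 0" using B r M0 by (simp add: \<delta>_def)
  have M\<delta>: "M * \<delta> \<le> r"
  proof -
    have "M * \<delta> \<le> (M + 1) * (r / (M + 1))"
      using M0 \<delta> by (intro mult_mono) (auto simp: \<delta>_def)
    then show ?thesis using M0 by simp
  qed
  have B\<delta>: "B * \<delta> \<le> 1 / 2"
  proof -
    have "B * \<delta> \<le> (B + 1) * (1 / (2 * (B + 1)))"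
      using B \<delta> by (intro mult_mono) (auto simp: \<delta>_def)
    also have "\<dots> = 1 / 2" using B by (simp add: field_simps)
    finally show ?thesis .
  qed
  define s where "s = (PiC UNIV (\<lambda>_. cball x0 r) :: (real \<Rightarrow>\<^sub>C 'a) set)"
  have s_iff: "c \<in> s \<longleftrightarrow> (\<forall>t. apply_bcontfun c t \<in> cball x0 r)" for c
    by (simp add: s_def mem_PiC_iff Pi_iff)
  then have sD: "apply_bcontfun c t \<in> cball x0 r" if "c \<in> s" for c t
    using that by blast
  have contX: "continuous_on UNIV (\<lambda>t. X (apply_bcontfun c t))" if "c \<in> s" for c
    using sD[OF that] lipschitz_on_continuous_on[OF lip]
    by (intro continuous_on_compose2[of "cball x0 r" X UNIV "apply_bcontfun c"]) auto
  \<comment> \<open>The integral from 0, written so that it also makes sense for negative times.\<close>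
  define P where "P = (\<lambda>c u. integral {-\<delta>..u} (\<lambda>t. X (apply_bcontfun c t))
                            - integral {-\<delta>..0} (\<lambda>t. X (apply_bcontfun c t)))"
  have P0: "P c 0 = 0" for c by (simp add: P_def)
  have derP: "(P c has_vector_derivative X (apply_bcontfun c u)) (at u within {-\<delta>..\<delta>})"
    if "c \<in> s" "u \<in> {-\<delta>..\<delta>}" for c u
  proof -
    have "continuous_on {-\<delta>..\<delta>} (\<lambda>t. X (apply_bcontfun c t))"
      using contX[OF that(1)] by (rule continuous_on_subset) simp
    from integral_has_vector_derivative[OF this that(2)]
    have "(P c has_vector_derivative X (apply_bcontfun c u) - 0) (at u within {-\<delta>..\<delta>})"
      unfolding P_def by (intro has_vector_derivative_diff has_vector_derivative_const)
    then show ?thesis by simp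
  qed
  have bound: "norm (g u) \<le> K * \<delta>"
    if "\<And>t. t \<in> {-\<delta>..\<delta>} \<Longrightarrow> (g has_vector_derivative g' t) (at t within {-\<delta>..\<delta>})"
      and bnd: "\<And>t. t \<in> {-\<delta>..\<delta>} \<Longrightarrow> norm (g' t) \<le> K" and "g 0 = 0" and "u \<in> {-\<delta>..\<delta>}" and "K \<ge> 0"
    for g g' :: "real \<Rightarrow> 'a" and K u
  proof -
    have "onorm (\<lambda>h. h *\<^sub>R g' t) \<le> K" if "t \<in> {-\<delta>..\<delta>}" for t
      using \<open>K \<ge> 0\<close> bnd[OF that]
      by (intro onorm_bound) (simp_all add: mult.commute[of K] mult_left_mono)
    then have "norm (g u - g 0) \<le> K * norm (u - 0)"
      using that \<delta> unfolding has_vector_derivative_def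
      by (intro differentiable_bound[of "{-\<delta>..\<delta>}" g "\<lambda>t h. h *\<^sub>R g' t"]) simp_all
    also have "\<dots> \<le> K * \<delta>" using that by (intro mult_left_mono) auto
    finally show ?thesis using that by simp
  qed
  define clamp where "clamp = (\<lambda>t. max (-\<delta>) (min \<delta> t))"
  have clamp: "clamp t \<in> {-\<delta>..\<delta>}" for t using \<delta> by (auto simp: clamp_def)
  have contclamp: "continuous_on UNIV clamp"
    unfolding clamp_def by (intro continuous_intros)
  have clamp_id: "clamp t = t" if "t \<in> {-\<delta>..\<delta>}" for t using that by (auto simp: clamp_def)
  define T where "T = (\<lambda>c. Bcontfun (\<lambda>t. x0 + P c (clamp t)))"
  have Pbound: "norm (P c u) \<le> r" if "c \<in> s" "u \<in> {-\<delta>..\<delta>}" for c u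
  proof -
    have "norm (P c u) \<le> M * \<delta>"
      using that M sD[OF that(1)] P0 M0 by (intro bound[OF derP[OF that(1)]]) auto
    then show ?thesis using M\<delta> by linarith
  qed
  have Tapp: "apply_bcontfun (T c) = (\<lambda>t. x0 + P c (clamp t))" if c: "c \<in> s" for c
    unfolding T_def
  proof (rule Bcontfun_inverse, rule bcontfun_normI)
    have "continuous_on {-\<delta>..\<delta>} (P c)"
      using derP[OF c] has_vector_derivative_continuous continuous_on_eq_continuous_within by blast
    then show "continuous_on UNIV (\<lambda>t. x0 + P c (clamp t))"
      using clamp
      by (intro continuous_on_add continuous_on_const continuous_on_compose2[of "{-\<delta>..\<delta>}" "P c" UNIV clamp])
        (simp_all add: image_subset_iff contclamp)
    show "norm (x0 + P c (clamp t)) \<le> norm x0 + r" for t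
      using Pbound[OF c clamp[of t]] by (smt (verit) norm_triangle_ineq)
  qed
  have "\<exists>!c. c \<in> s \<and> T c = c"
  proof (rule Banach_fix[where c = "1/2"])
    show "complete s" unfolding s_def complete_eq_closed by (intro closed_PiC) auto
    have "const_bcontfun x0 \<in> s"
      using r by (simp add: s_iff const_bcontfun.rep_eq)
    then show "s \<noteq> {}" by blast
    have "T c \<in> s" if "c \<in> s" for c
      unfolding s_iff using Pbound[OF that clamp] by (simp add: Tapp[OF that] dist_norm)
    then show "T ` s \<subseteq> s" by blast
    show "dist (T c) (T c') \<le> 1 / 2 * dist c c'" if "c \<in> s" "c' \<in> s" for c c'
    proof (rule dist_bound)
      fix t
      have "norm (P c (clamp t) - P c' (clamp t)) \<le> (B * dist c c') * \<delta>"
      proof (rule bound[OF has_vector_derivative_diff[OF derP[OF that(1)] derP[OF that(2)]]])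
        fix u
        have "dist (X (apply_bcontfun c u)) (X (apply_bcontfun c' u))
                \<le> B * dist (apply_bcontfun c u) (apply_bcontfun c' u)"
          using sD that by (intro lipschitz_onD[OF lip])
        also have "\<dots> \<le> B * dist c c'"
          using B by (intro mult_left_mono dist_bounded)
        finally show "norm (X (apply_bcontfun c u) - X (apply_bcontfun c' u)) \<le> B * dist c c'"
          by (simp add: dist_norm)
      qed (use B P0 clamp in auto)
      also have "\<dots> = (B * \<delta>) * dist c c'" by simp
      also have "\<dots> \<le> 1 / 2 * dist c c'" using B\<delta> by (intro mult_right_mono) auto
      finally show "dist (apply_bcontfun (T c) t) (apply_bcontfun (T c') t) \<le> 1 / 2 * dist c c'"
        using that by (simp add: Tapp dist_norm)
    qed
  qed auto
  then obtain c where c: "c \<in> s" "T c = c" by blast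
  have ceq: "apply_bcontfun c t = x0 + P c t" if "t \<in> {-\<delta>..\<delta>}" for t
    using Tapp[OF c(1)] clamp_id[OF that] by (metis c(2))
  show ?thesis
  proof (rule that)
    show "\<delta> > 0" by fact
    show "apply_bcontfun c 0 = x0" using ceq[of 0] P0 \<delta> by simp
    show "apply_bcontfun c t \<in> cball x0 r" for t using sD c by blast
    fix t :: real assume "\<bar>t\<bar> < \<delta>"
    then have t: "t \<in> {-\<delta><..<\<delta>}" by auto
    then have "(P c has_vector_derivative X (apply_bcontfun c t)) (at t within {-\<delta><..<\<delta>})"
      by (intro has_vector_derivative_within_subset[OF derP[OF c(1), of t]]) auto
    then have der: "((\<lambda>t. x0 + P c t) has_vector_derivative 0 + X (apply_bcontfun c t)) (at t)"
      using t by (intro has_vector_derivative_add has_vector_derivative_const)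
        (simp add: at_within_open[of t "{-\<delta><..<\<delta>}"])
    have "x0 + P c u = apply_bcontfun c u" if "u \<in> {-\<delta><..<\<delta>}" for u
      using that by (intro ceq[symmetric]) simp
    from has_vector_derivative_transform_within_open[OF der open_greaterThanLessThan t this]
    show "(apply_bcontfun c has_vector_derivative X (apply_bcontfun c t)) (at t)"
      by simp
  qed
qed

section \<open>Smooth functions on open sets\<close>

lemma frechet_derivative_cong_open:
  assumes "open S" "x \<in> S" "\<And>y. y \<in> S \<Longrightarrow> f y = g y"
  shows "frechet_derivative f (at x) = frechet_derivative g (at x)"
proof -
  have "(f has_derivative D) (at x) \<longleftrightarrow> (g has_derivative D) (at x)" for D
    using assms has_derivative_transform_within_open[of f D x UNIV S g]
      has_derivative_transform_within_open[of g D x UNIV S f] by metis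
  then show ?thesis by (simp add: frechet_derivative_def)
qed

lemma differentiable_times_cong_open:
  assumes "open S" "\<And>x. x \<in> S \<Longrightarrow> f x = g x" "differentiable_times n S f"
  shows "differentiable_times n S g"
  using assms(2,3)
proof (induction n arbitrary: f g)
  case 0
  then show ?case by (simp cong: continuous_on_cong)
next
  case (Suc n)
  have eq: "frechet_derivative f (at x) = frechet_derivative g (at x)" if "x \<in> S" for x
    using assms(1) that Suc.prems(1) by (rule frechet_derivative_cong_open)
  have "differentiable_times n S (\<lambda>x. frechet_derivative g (at x) v)" for v
    using Suc.IH[of "\<lambda>x. frechet_derivative f (at x) v" "\<lambda>x. frechet_derivative g (at x) v"]
      Suc.prems(2) eq by simp
  moreover have "g differentiable (at x)" if "x \<in> S" for x
    using Suc.prems that has_derivative_transform_within_open[of f _ x UNIV S g] assms(1)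
    unfolding differentiable_times.simps differentiable_def by metis
  ultimately show ?case by simp
qed

lemma smooth_on_cong_open:
  assumes "open S" "\<And>x. x \<in> S \<Longrightarrow> f x = g x" "smooth_on S f"
  shows "smooth_on S g"
  using assms differentiable_times_cong_open unfolding smooth_on_def by metis

lemma smooth_on_imp_differentiable:
  assumes "smooth_on S f" "x \<in> S"
  shows "f differentiable (at x)"
proof -
  have "differentiable_times (Suc 0) S f" using assms(1) unfolding smooth_on_def by blast
  with assms(2) show ?thesis by simp
qed

lemma smooth_on_imp_differentiable2:
  assumes "smooth_on S f" "x \<in> S"
  shows "(\<lambda>y. frechet_derivative f (at y) v) differentiable (at x)"
proof -
  have "differentiable_times (Suc (Suc 0)) S f" using assms(1) unfolding smooth_on_def by blast
  with assms(2) show ?thesis by simp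
qed

section \<open>Charts of a smooth manifold\<close>

context
  fixes M :: "('m, 'e::{banach,heine_borel}) manifold"
  assumes M: "smooth_manifold M"
begin

lemma cdom_openin: "k \<in> atlas M \<Longrightarrow> openin (mtop M) (cdom k)"
  using M unfolding smooth_manifold_def by blast

lemma cdom_subset_points: "k \<in> atlas M \<Longrightarrow> cdom k \<subseteq> points M"
  using cdom_openin openin_subset by blast

lemma open_chart_image: "k \<in> atlas M \<Longrightarrow> open (cmap k ` cdom k)"
  using M unfolding smooth_manifold_def by blast

lemma chart_at_atlas: "p \<in> points M \<Longrightarrow> chart_at M p \<in> atlas M"
  and in_cdom_chart_at: "p \<in> points M \<Longrightarrow> p \<in> cdom (chart_at M p)"
  using M unfolding smooth_manifold_def by blast+

lemma homeomorphic_map_chart: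
  "k \<in> atlas M \<Longrightarrow>
     homeomorphic_map (subtopology (mtop M) (cdom k)) (top_of_set (cmap k ` cdom k)) (cmap k)"
  using M unfolding smooth_manifold_def by blast

lemma topspace_chart: "k \<in> atlas M \<Longrightarrow> topspace (subtopology (mtop M) (cdom k)) = cdom k"
  using cdom_subset_points[of k] by auto

lemma inj_on_chart: "k \<in> atlas M \<Longrightarrow> inj_on (cmap k) (cdom k)"
  using homeomorphic_map_chart[of k] topspace_chart[of k]
  unfolding homeomorphic_eq_everything_map by simp

lemma cinv_cmap: "k \<in> atlas M \<Longrightarrow> p \<in> cdom k \<Longrightarrow> cinv k (cmap k p) = p"
  unfolding cinv_def using inj_on_chart by (rule inv_into_f_f)

lemma cmap_cinv: "x \<in> cmap k ` cdom k \<Longrightarrow> cmap k (cinv k x) = x"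
  unfolding cinv_def by (rule f_inv_into_f)

lemma cinv_in_cdom: "x \<in> cmap k ` cdom k \<Longrightarrow> cinv k x \<in> cdom k"
  unfolding cinv_def by (rule inv_into_into)

lemma open_chart_overlap:
  assumes "k \<in> atlas M" "k' \<in> atlas M"
  shows "open (cmap k ` (cdom k \<inter> cdom k'))"
proof -
  have "openin (subtopology (mtop M) (cdom k)) (cdom k \<inter> cdom k')"
    using cdom_openin[OF assms(2)] by (metis inf_commute openin_subtopology_Int)
  then have "openin (top_of_set (cmap k ` cdom k)) (cmap k ` (cdom k \<inter> cdom k'))"
    using homeomorphic_map_chart[OF assms(1)]
    unfolding homeomorphic_eq_everything_map open_map_def by blast
  then show ?thesis
    using open_chart_image[OF assms(1)] openin_open_trans by blast
qed

lemma continuous_map_cinv: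
  assumes k: "k \<in> atlas M"
  shows "continuous_map (top_of_set (cmap k ` cdom k)) (mtop M) (cinv k)"
proof -
  obtain g where g: "homeomorphic_maps (subtopology (mtop M) (cdom k))
      (top_of_set (cmap k ` cdom k)) (cmap k) g"
    using homeomorphic_map_chart[OF k] homeomorphic_map_maps by blast
  then have "continuous_map (top_of_set (cmap k ` cdom k)) (mtop M) g"
    by (simp add: homeomorphic_maps_def continuous_map_in_subtopology)
  moreover have "g x = cinv k x" if "x \<in> cmap k ` cdom k" for x
    using g that cinv_cmap[OF k] topspace_chart[OF k] by (auto simp: homeomorphic_maps_def)
  ultimately show ?thesis
    using continuous_map_eq[of "top_of_set (cmap k ` cdom k)" "mtop M" g "cinv k"] by simp
qed

lemma transition_differentiable:
  assumes "k \<in> atlas M" "k' \<in> atlas M" "p \<in> cdom k" "p \<in> cdom k'"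
  shows "(cmap k' \<circ> cinv k) differentiable (at (cmap k p))"
proof (rule smooth_on_imp_differentiable)
  show "smooth_on (cmap k ` (cdom k \<inter> cdom k')) (cmap k' \<circ> cinv k)"
    using M assms unfolding smooth_manifold_def by blast
qed (use assms in auto)

text \<open>
  The differential of a map does not depend on the chart. It is stated for an arbitrary target,
  so that it covers functions as well as further charts (\<open>coord_change_trans\<close>).
\<close>

lemma has_derivative_chart_change:
  assumes "k \<in> atlas M" "k' \<in> atlas M" "p \<in> cdom k" "p \<in> cdom k'"
    and D: "((g \<circ> cinv k') has_derivative D) (at (cmap k' p))"
  shows "((g \<circ> cinv k) has_derivative (\<lambda>v. D (coord_change k k' p v))) (at (cmap k p))"
proof -
  have "((cmap k' \<circ> cinv k) has_derivative coord_change k k' p) (at (cmap k p))"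
    using transition_differentiable[OF assms(1-4)]
    unfolding frechet_derivative_works coord_change_def .
  moreover have "(cmap k' \<circ> cinv k) (cmap k p) = cmap k' p"
    using cinv_cmap assms by simp
  ultimately have "((\<lambda>x. (g \<circ> cinv k') ((cmap k' \<circ> cinv k) x)) has_derivative
      (\<lambda>v. D (coord_change k k' p v))) (at (cmap k p))"
    using D by (metis has_derivative_compose)
  then show ?thesis
  proof (rule has_derivative_transform_within_open)
    show "open (cmap k ` (cdom k \<inter> cdom k'))" using assms open_chart_overlap by blast
    show "cmap k p \<in> cmap k ` (cdom k \<inter> cdom k')" using assms by blast
  qed (auto simp: cinv_cmap assms)
qed

lemma coord_change_trans:
  assumes "k \<in> atlas M" "k' \<in> atlas M" "k'' \<in> atlas M"
    and "p \<in> cdom k" "p \<in> cdom k'" "p \<in> cdom k''"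
  shows "coord_change k' k'' p (coord_change k k' p v) = coord_change k k'' p v"
proof -
  have "((cmap k'' \<circ> cinv k') has_derivative coord_change k' k'' p) (at (cmap k' p))"
    using transition_differentiable[of k' k'' p] assms
    unfolding frechet_derivative_works coord_change_def by blast
  from has_derivative_chart_change[OF assms(1,2,4,5) this]
  show ?thesis unfolding coord_change_def[of k k''] by (metis frechet_derivative_at)
qed

lemma coord_change_refl:
  assumes "k \<in> atlas M" "p \<in> cdom k"
  shows "coord_change k k p v = v"
proof -
  have "frechet_derivative (cmap k \<circ> cinv k) (at (cmap k p)) = frechet_derivative (\<lambda>x. x) (at (cmap k p))"
    using assms
    by (intro frechet_derivative_cong_open[OF open_chart_image[OF assms(1)]]) (auto simp: cinv_cmap)
  then show ?thesis by (simp add: coord_change_def)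
qed

section \<open>Local flows\<close>

text \<open>
  The curve solves the differential equation given by \<open>V\<close> in the chart around \<open>p\<close>. An integral
  curve must have velocity \<open>V\<close> in the chart preferred at each of its points, and these charts vary
  along the curve; the cocycle rule for coordinate changes translates between them.
\<close>

lemma local_flow:
  assumes V: "smooth_vector_field M V" and p: "p \<in> points M"
  obtains \<delta> \<gamma> where "\<delta> > 0"
    "\<gamma> 0 = p"
    "\<And>t. \<bar>t\<bar> < \<delta> \<Longrightarrow> \<gamma> t \<in> cdom (chart_at M p)"
    "\<And>t. \<bar>t\<bar> < \<delta> \<Longrightarrow> flows_to M V t p (\<gamma> t)"
    "((\<lambda>t. cmap (chart_at M p) (\<gamma> t)) has_vector_derivative V p) (at 0)"
proof -
  define k where "k = chart_at M p"
  have k: "k \<in> atlas M" "p \<in> cdom k"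
    using p chart_at_atlas in_cdom_chart_at by (auto simp: k_def)
  define S where "S = cmap k ` cdom k"
  define X where "X = (\<lambda>q. coord_change (chart_at M q) k q (V q)) \<circ> cinv k"
  have "open S" using open_chart_image k by (simp add: S_def)
  moreover have "cmap k p \<in> S" using k by (auto simp: S_def)
  moreover have "smooth_on S X"
    using V k unfolding smooth_vector_field_def X_def S_def by blast
  ultimately obtain r B where r: "r > 0" "cball (cmap k p) r \<subseteq> S"
    and "B-lipschitz_on (cball (cmap k p) r) X"
    by (rule smooth_on_imp_lipschitz_on_cball)
  then obtain \<delta> c where \<delta>: "\<delta> > 0" and c0: "c 0 = cmap k p"
    and cr: "\<And>t. \<bar>t\<bar> < \<delta> \<Longrightarrow> c t \<in> cball (cmap k p) r"
    and c': "\<And>t. \<bar>t\<bar> < \<delta> \<Longrightarrow> (c has_vector_derivative X (c t)) (at t)"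
    using picard_lindelof_autonomous[of r B "cmap k p" X] by blast
  have cS: "c t \<in> S" if "\<bar>t\<bar> < \<delta>" for t
    using cr[OF that] r by blast
  define I where "I = {-\<delta><..<\<delta>}"
  have I: "t \<in> I \<longleftrightarrow> \<bar>t\<bar> < \<delta>" for t by (auto simp: I_def)
  define \<gamma> where "\<gamma> = (\<lambda>t. cinv k (c t))"
  have \<gamma>_dom: "\<gamma> t \<in> cdom k" if "t \<in> I" for t
    using cS that unfolding \<gamma>_def S_def I by (blast intro: cinv_in_cdom)
  have \<gamma>_pts: "\<gamma> t \<in> points M" if "t \<in> I" for t
    using \<gamma>_dom[OF that] cdom_subset_points[OF k(1)] by blast
  have cmap_\<gamma>: "cmap k (\<gamma> t) = c t" if "t \<in> I" for t
    using cS that unfolding \<gamma>_def S_def I by (blast intro: cmap_cinv)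
  have \<gamma>0: "\<gamma> 0 = p" using c0 k by (simp add: \<gamma>_def cinv_cmap)
  have "continuous_on I c"
    using c' has_vector_derivative_continuous continuous_at_imp_continuous_on by (metis I)
  then have "continuous_map (top_of_set I) (top_of_set S) c"
    using cS by (auto simp: I)
  from continuous_map_compose[OF this continuous_map_cinv[OF k(1), folded S_def]]
  have cont: "continuous_map (top_of_set I) (mtop M) \<gamma>"
    by (simp add: \<gamma>_def o_def)
  have der: "((cmap (chart_at M (\<gamma> t)) \<circ> \<gamma>) has_vector_derivative V (\<gamma> t)) (at t)" if t: "t \<in> I" for t
  proof -
    let ?k' = "chart_at M (\<gamma> t)"
    have k': "?k' \<in> atlas M" "\<gamma> t \<in> cdom ?k'"
      using \<gamma>_pts[OF t] chart_at_atlas in_cdom_chart_at by auto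
    have "((cmap ?k' \<circ> cinv k) has_derivative coord_change k ?k' (\<gamma> t)) (at (c t))"
      using transition_differentiable[OF k(1) k'(1) \<gamma>_dom[OF t] k'(2)] cmap_\<gamma>[OF t]
      unfolding frechet_derivative_works coord_change_def by simp
    moreover have "(c has_vector_derivative X (c t)) (at t)" using c' t I by blast
    ultimately have "((cmap ?k' \<circ> cinv k \<circ> c) has_vector_derivative coord_change k ?k' (\<gamma> t) (X (c t))) (at t)"
      by (metis has_derivative_at_withinI vector_derivative_diff_chain_within)
    moreover have "coord_change k ?k' (\<gamma> t) (X (c t)) = V (\<gamma> t)"
    proof -
      have "X (c t) = coord_change ?k' k (\<gamma> t) (V (\<gamma> t))" by (simp add: X_def \<gamma>_def)
      then show ?thesis
        using coord_change_trans[of ?k' k ?k' "\<gamma> t"] k k' \<gamma>_dom[OF t] coord_change_refl by simp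
    qed
    ultimately show ?thesis by (simp add: \<gamma>_def o_def)
  qed
  show ?thesis
  proof (rule that[of \<delta> \<gamma>])
    show "\<gamma> t \<in> cdom (chart_at M p)" if "\<bar>t\<bar> < \<delta>" for t
      using \<gamma>_dom that I by (simp add: k_def)
    show "flows_to M V t p (\<gamma> t)" if "\<bar>t\<bar> < \<delta>" for t
      unfolding flows_to_def integral_curve_def
      using that \<delta> cont der \<gamma>0 
      by (intro exI[of _ I] exI[of _ \<gamma>]) (auto simp: I_def is_interval_oo)
    show "((\<lambda>t. cmap (chart_at M p) (\<gamma> t)) has_vector_derivative V p) (at 0)"
      using der[of 0] \<delta> \<gamma>0 by (simp add: I o_def)
  qed (use \<delta> \<gamma>0 in auto)
qed

end

section \<open>The Lagrangian in charts\<close>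

abbreviation chart_image :: "('m, 'e) chart \<Rightarrow> 'e set" where
  "chart_image k \<equiv> cmap k ` cdom k"

text \<open>
  The chart used at each vertex is a parameter: along a variation of a section the charts stay
  those of the original section, whereas \<^const>\<open>partial_L\<close> always refers to the preferred chart
  at the current value.
\<close>

definition local_lagrangian ::
    "(triangle \<times> 'f \<times> 'f \<times> 'f \<Rightarrow> real) \<Rightarrow> triangle \<Rightarrow> (nat \<Rightarrow> ('f, 'e) chart) \<Rightarrow>
     'e \<times> 'e \<times> 'e \<Rightarrow> real" where
  "local_lagrangian L \<Delta> k =
     (\<lambda>(x1, x2, x3). L (\<Delta>, cinv (k 1) x1, cinv (k 2) x2, cinv (k 3) x3))"

definition jet_chart ::
    "triangle \<Rightarrow> (nat \<Rightarrow> ('f, 'e) chart) \<Rightarrow> (triangle \<times> 'f \<times> 'f \<times> 'f, 'e \<times> 'e \<times> 'e) chart" where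
  "jet_chart \<Delta> k =
     ({\<Delta>} \<times> cdom (k 1) \<times> cdom (k 2) \<times> cdom (k 3),
      map_prod (cmap (k 1)) (map_prod (cmap (k 2)) (cmap (k 3))) \<circ> snd)"

lemma cdom_jet_chart:
  "cdom (jet_chart \<Delta> k) = {\<Delta>} \<times> cdom (k 1) \<times> cdom (k 2) \<times> cdom (k 3)"
  and cmap_jet_chart:
  "cmap (jet_chart \<Delta> k) (\<Delta>', y1, y2, y3) = (cmap (k 1) y1, cmap (k 2) y2, cmap (k 3) y3)"
  by (simp_all add: jet_chart_def)

lemma chart_image_jet_chart:
  "chart_image (jet_chart \<Delta> k) = chart_image (k 1) \<times> chart_image (k 2) \<times> chart_image (k 3)"
  unfolding jet_chart_def by (auto simp: image_iff)

lemma chart_at_jet_bundle: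
  "chart_at (jet_bundle F) (\<Delta>, y) = jet_chart \<Delta> (\<lambda>l. chart_at F (comp3 y l))"
  by (simp add: jet_bundle_def copies_def prod_manifold_def jet_chart_def comp3_def split: prod.splits)

lemma copies_atlasI:
  "i \<in> I \<Longrightarrow> k \<in> atlas M \<Longrightarrow> ({i} \<times> cdom k, cmap k \<circ> snd) \<in> atlas (copies I M)"
  unfolding copies_def manifold.simps by blast

lemma prod_atlasI:
  "k \<in> atlas M \<Longrightarrow> k' \<in> atlas N \<Longrightarrow>
     (cdom k \<times> cdom k', map_prod (cmap k) (cmap k')) \<in> atlas (prod_manifold M N)"
  unfolding prod_manifold_def manifold.simps by blast

lemma jet_chart_atlas:
  assumes "\<Delta> \<in> triangles" "\<And>l. l \<in> {1..3} \<Longrightarrow> k l \<in> atlas F"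
  shows "jet_chart \<Delta> k \<in> atlas (jet_bundle F)"
proof -
  have "k 1 \<in> atlas F" "k 2 \<in> atlas F" "k 3 \<in> atlas F" using assms(2) by auto
  from copies_atlasI[OF assms(1) prod_atlasI[OF this(1) prod_atlasI[OF this(2,3)]]]
  show ?thesis unfolding jet_bundle_def jet_chart_def by simp
qed

lemma upd3_has_derivative:
  fixes c :: "'e::real_normed_vector \<times> 'e \<times> 'e"
  shows "((\<lambda>z. upd3 c l z) has_derivative upd3 0 l) (at x)"
proof -
  obtain c1 c2 c3 where c: "c = (c1, c2, c3)" by (cases c)
  have "((\<lambda>z. (z, c2, c3)) has_derivative (\<lambda>z. (z, 0, 0))) (at x)"
    "((\<lambda>z. (c1, z, c3)) has_derivative (\<lambda>z. (0, z, 0))) (at x)"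
    "((\<lambda>z. (c1, c2, z)) has_derivative (\<lambda>z. (0, 0, z))) (at x)"
    by (auto intro!: derivative_eq_intros simp: zero_prod_def)
  moreover have "upd3 c l = (if l = 1 then (\<lambda>z. (z, c2, c3)) else if l = 2 then (\<lambda>z. (c1, z, c3))
      else (\<lambda>z. (c1, c2, z)))"
    "upd3 (0::'e \<times> 'e \<times> 'e) l = (if l = 1 then (\<lambda>z. (z, 0, 0)) else if l = 2 then (\<lambda>z. (0, z, 0))
      else (\<lambda>z. (0, 0, z)))"
    by (auto simp: upd3_def c zero_prod_def)
  ultimately show ?thesis by simp
qed

lemma sum_upd3_comp3:
  fixes w :: "'e::real_normed_vector \<times> 'e \<times> 'e"
  shows "(\<Sum>l\<in>{1..3}. upd3 0 l (comp3 w l)) = w"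
proof -
  have "{1..3} = {1, 2, 3::nat}" by auto
  then show ?thesis by (cases w) (simp add: upd3_def comp3_def zero_prod_def)
qed

context
  fixes F :: "('f, 'e::{banach,heine_borel}) manifold"
  assumes F: "smooth_manifold F"
begin

lemma cinv_jet_chart:
  assumes k: "\<And>l. l \<in> {1..3} \<Longrightarrow> k l \<in> atlas F" and x: "x \<in> chart_image (jet_chart \<Delta> k)"
  shows "cinv (jet_chart \<Delta> k) x =
           (\<Delta>, cinv (k 1) (comp3 x 1), cinv (k 2) (comp3 x 2), cinv (k 3) (comp3 x 3))"
proof -
  have k': "k 1 \<in> atlas F" "k 2 \<in> atlas F" "k 3 \<in> atlas F" using k by auto
  then have "inj_on (cmap (jet_chart \<Delta> k)) (cdom (jet_chart \<Delta> k))"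
    using inj_on_chart[OF F] by (auto simp: inj_on_def cdom_jet_chart cmap_jet_chart)
  moreover obtain x1 x2 x3 where "x = (x1, x2, x3)" by (cases x)
  ultimately show ?thesis
    unfolding cinv_def[of "jet_chart \<Delta> k"] using x
    by (intro inv_into_f_eq)
      (auto simp: cdom_jet_chart cmap_jet_chart chart_image_jet_chart comp3_def
        cmap_cinv[OF F] cinv_in_cdom[OF F] simp del: image_iff)
qed

lemma open_jet_chart_image:
  assumes "\<And>l. l \<in> {1..3} \<Longrightarrow> k l \<in> atlas F"
  shows "open (chart_image (jet_chart \<Delta> k))"
  unfolding chart_image_jet_chart
  using assms by (intro open_Times open_chart_image[OF F]) auto

text \<open>
  Charts of the jet bundle are products, so their transition maps and derivatives act
  componentwise.
\<close>

lemma coord_change_jet_chart: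
  assumes k: "\<And>l. l \<in> {1..3} \<Longrightarrow> k l \<in> atlas F" and k': "\<And>l. l \<in> {1..3} \<Longrightarrow> k' l \<in> atlas F"
    and y: "\<And>l. l \<in> {1..3} \<Longrightarrow> comp3 y l \<in> cdom (k l)"
    and y': "\<And>l. l \<in> {1..3} \<Longrightarrow> comp3 y l \<in> cdom (k' l)"
    and l: "l \<in> {1..3}"
  shows "comp3 (coord_change (jet_chart \<Delta> k) (jet_chart \<Delta> k') (\<Delta>, y) w) l =
         coord_change (k l) (k' l) (comp3 y l) (comp3 w l)"
proof -
  obtain y1 y2 y3 where y123: "y = (y1, y2, y3)" by (cases y)
  obtain w1 w2 w3 where w123: "w = (w1, w2, w3)" by (cases w)
  have tr: "((cmap (k' i) \<circ> cinv (k i)) has_derivative coord_change (k i) (k' i) (comp3 y i))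
      (at (cmap (k i) (comp3 y i)))" if "i \<in> {1..3}" for i
    using transition_differentiable[OF F k[OF that] k'[OF that] y[OF that] y'[OF that]]
    unfolding frechet_derivative_works coord_change_def .
  let ?c = "\<lambda>i. cmap (k' i) \<circ> cinv (k i)"
  let ?D = "\<lambda>i. coord_change (k i) (k' i) (comp3 y i)"
  let ?x = "(cmap (k 1) y1, cmap (k 2) y2, cmap (k 3) y3)"
  have fst: "(fst has_derivative fst) (at z)" and snd: "(snd has_derivative snd) (at z)"
    for z :: "'x::real_normed_vector \<times> 'y::real_normed_vector"
    by (auto intro!: derivative_eq_intros)
  have "((\<lambda>x. (?c 1 (fst x), ?c 2 (fst (snd x)), ?c 3 (snd (snd x)))) has_derivative
      (\<lambda>v. (?D 1 (fst v), ?D 2 (fst (snd v)), ?D 3 (snd (snd v))))) (at ?x)"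
    using tr[of 1] tr[of 2] tr[of 3]
    by (intro has_derivative_Pair has_derivative_compose[OF fst]
          has_derivative_compose[OF has_derivative_compose[OF snd fst]]
          has_derivative_compose[OF has_derivative_compose[OF snd snd]]) (simp_all add: y123 comp3_def o_def)
  then have "((cmap (jet_chart \<Delta> k') \<circ> cinv (jet_chart \<Delta> k)) has_derivative
      (\<lambda>v. (?D 1 (fst v), ?D 2 (fst (snd v)), ?D 3 (snd (snd v))))) (at ?x)"
  proof (rule has_derivative_transform_within_open)
    show "open (chart_image (jet_chart \<Delta> k))" using k by (rule open_jet_chart_image)
    show "?x \<in> chart_image (jet_chart \<Delta> k)"
      using y[of 1] y[of 2] y[of 3] by (simp add: chart_image_jet_chart y123 comp3_def)
    fix x assume "x \<in> chart_image (jet_chart \<Delta> k)"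
    from cinv_jet_chart[where k = k, OF k this]
    show "(?c 1 (fst x), ?c 2 (fst (snd x)), ?c 3 (snd (snd x))) =
        (cmap (jet_chart \<Delta> k') \<circ> cinv (jet_chart \<Delta> k)) x"
      by (cases x) (simp add: cmap_jet_chart comp3_def)
  qed
  from frechet_derivative_at[OF this]
  have "coord_change (jet_chart \<Delta> k) (jet_chart \<Delta> k') (\<Delta>, y) w =
      (?D 1 w1, ?D 2 w2, ?D 3 w3)"
    unfolding coord_change_def[of "jet_chart \<Delta> k"] by (simp add: y123 w123 cmap_jet_chart fun_eq_iff)
  moreover have "l = 1 \<or> l = 2 \<or> l = 3" using l by auto
  ultimately show ?thesis
    by (elim disjE) (simp_all add: comp3_def w123)
qed

context
  fixes L :: "triangle \<times> 'f \<times> 'f \<times> 'f \<Rightarrow> real"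
  assumes L: "smooth_function (jet_bundle F) L"
begin

lemma local_lagrangian_smooth:
  assumes "\<Delta> \<in> triangles" and k: "\<And>l. l \<in> {1..3} \<Longrightarrow> k l \<in> atlas F"
  shows "smooth_on (chart_image (jet_chart \<Delta> k)) (local_lagrangian L \<Delta> k)"
proof (rule smooth_on_cong_open)
  show "smooth_on (chart_image (jet_chart \<Delta> k)) (L \<circ> cinv (jet_chart \<Delta> k))"
    using L jet_chart_atlas[where k = k, OF assms] unfolding smooth_function_def by blast
  show "(L \<circ> cinv (jet_chart \<Delta> k)) x = local_lagrangian L \<Delta> k x"
    if "x \<in> chart_image (jet_chart \<Delta> k)" for x
    using cinv_jet_chart[where k = k, OF k that] by (cases x) (simp add: local_lagrangian_def comp3_def)
qed (use open_jet_chart_image k in blast)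

text \<open>
  The left side is computed in the preferred chart at \<open>y\<^sup>l\<close>, the right side in the chart
  \<open>k l\<close>. The proof differentiates \<open>z \<mapsto> L(\<Delta>, \<dots>, z, \<dots>)\<close> in both charts, using that it is
  the local Lagrangian with the \<open>l\<close>-th chart replaced, and compares by \<open>has_derivative_chart_change\<close>.
\<close>

lemma partial_L_in_charts:
  assumes \<Delta>: "\<Delta> \<in> triangles" and k: "\<And>l. l \<in> {1..3} \<Longrightarrow> k l \<in> atlas F"
    and y: "\<And>l. l \<in> {1..3} \<Longrightarrow> comp3 y l \<in> cdom (k l)"
    and l: "l \<in> {1..3}"
  shows "partial_L F L l (\<Delta>, y) (coord_change (k l) (chart_at F (comp3 y l)) (comp3 y l) w) =
         frechet_derivative (local_lagrangian L \<Delta> k) (at (cmap (jet_chart \<Delta> k) (\<Delta>, y))) (upd3 0 l w)"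
proof -
  define g where "g = (\<lambda>z. L (\<Delta>, upd3 y l z))"
  obtain y1 y2 y3 where y123: "y = (y1, y2, y3)" by (cases y)
  have der: "((g \<circ> cinv \<kappa>) has_derivative
      (\<lambda>w. frechet_derivative (local_lagrangian L \<Delta> (k(l := \<kappa>)))
             (at (cmap (jet_chart \<Delta> (k(l := \<kappa>))) (\<Delta>, y))) (upd3 0 l w))) (at (cmap \<kappa> (comp3 y l)))"
    if \<kappa>: "\<kappa> \<in> atlas F" "comp3 y l \<in> cdom \<kappa>" for \<kappa>
  proof -
    let ?k = "k(l := \<kappa>)"
    have k': "?k i \<in> atlas F" "comp3 y i \<in> cdom (?k i)" if "i \<in> {1..3}" for i
      using that k y \<kappa> by auto
    let ?x = "cmap (jet_chart \<Delta> ?k) (\<Delta>, y)"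
    have "(\<Delta>, y) \<in> cdom (jet_chart \<Delta> ?k)"
      using k'(2)[of 1] k'(2)[of 2] k'(2)[of 3] by (simp add: cdom_jet_chart y123 comp3_def)
    then have "local_lagrangian L \<Delta> ?k differentiable (at ?x)"
      using smooth_on_imp_differentiable[OF local_lagrangian_smooth[where k = ?k, OF \<Delta> k'(1)]] by blast
    moreover have x: "upd3 ?x l (cmap \<kappa> (comp3 y l)) = ?x"
      using l by (auto simp: y123 cmap_jet_chart upd3_def comp3_def)
    ultimately have "((\<lambda>z. local_lagrangian L \<Delta> ?k (upd3 ?x l z)) has_derivative
        (\<lambda>w. frechet_derivative (local_lagrangian L \<Delta> ?k) (at ?x) (upd3 0 l w)))
        (at (cmap \<kappa> (comp3 y l)))"
      unfolding frechet_derivative_works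
      by (intro has_derivative_compose[OF upd3_has_derivative]) (simp only:)
    moreover have "local_lagrangian L \<Delta> ?k (upd3 ?x l z) = (g \<circ> cinv \<kappa>) z" for z
    proof -
      have "cinv (?k i) (cmap (?k i) (comp3 y i)) = comp3 y i" if "i \<in> {1..3}" for i
        using cinv_cmap[OF F k'[OF that]] .
      from this[of 1] this[of 2] this[of 3] show ?thesis
        using l by (auto simp: y123 comp3_def upd3_def local_lagrangian_def cmap_jet_chart g_def)
    qed
    ultimately show ?thesis by (simp add: o_def)
  qed
  have p: "comp3 y l \<in> points F"
    using y[OF l] cdom_subset_points[OF F k[OF l]] by blast
  let ?k' = "chart_at F (comp3 y l)"
  have k': "?k' \<in> atlas F" "comp3 y l \<in> cdom ?k'"
    using chart_at_atlas[OF F p] in_cdom_chart_at[OF F p] by auto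
  have "((g \<circ> cinv ?k') has_derivative
      frechet_derivative (g \<circ> cinv ?k') (at (cmap ?k' (comp3 y l)))) (at (cmap ?k' (comp3 y l)))"
    using der[OF k'] frechet_derivative_works differentiableI by blast
  from has_derivative_chart_change[OF F k[OF l] k'(1) y[OF l] k'(2) this] der[OF k[OF l] y[OF l]]
  have "(\<lambda>v. frechet_derivative (g \<circ> cinv ?k') (at (cmap ?k' (comp3 y l)))
               (coord_change (k l) ?k' (comp3 y l) v)) =
        (\<lambda>w. frechet_derivative (local_lagrangian L \<Delta> k) (at (cmap (jet_chart \<Delta> k) (\<Delta>, y))) (upd3 0 l w))"
    using has_derivative_unique by (metis fun_upd_triv)
  then show ?thesis
    by (simp add: partial_L_def differential_def g_def fun_eq_iff)
qed

text \<open>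
  In a fixed chart, \<open>\<Theta>\<^sup>l\<close> is a partial derivative of the local Lagrangian on the whole chart domain and
  not just at its centre, which is what its exterior derivative needs.
\<close>

lemma Theta_in_jet_chart:
  assumes \<Delta>: "\<Delta> \<in> triangles" and k: "\<And>l. l \<in> {1..3} \<Longrightarrow> k l \<in> atlas F"
    and x: "x \<in> chart_image (jet_chart \<Delta> k)" and l: "l \<in> {1..3}"
  shows "form_in_chart (jet_bundle F) (Theta F L l) (jet_chart \<Delta> k) x w =
         frechet_derivative (local_lagrangian L \<Delta> k) (at x) (upd3 0 l (comp3 w l))"
proof -
  define y where "y = (cinv (k 1) (comp3 x 1), cinv (k 2) (comp3 x 2), cinv (k 3) (comp3 x 3))"
  have p: "cinv (jet_chart \<Delta> k) x = (\<Delta>, y)"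
    using cinv_jet_chart[where k = k, OF k x] by (simp add: y_def)
  have "(\<Delta>, y) \<in> cdom (jet_chart \<Delta> k)"
    using x inv_into_into[OF x] by (simp add: p[symmetric] cinv_def)
  then have y: "comp3 y i \<in> cdom (k i)" if "i \<in> {1..3}" for i
  proof -
    have "i = 1 \<or> i = 2 \<or> i = 3" using that by auto
    with \<open>(\<Delta>, y) \<in> cdom (jet_chart \<Delta> k)\<close> show ?thesis
      by (cases y) (auto simp: cdom_jet_chart comp3_def)
  qed
  let ?k' = "\<lambda>i. chart_at F (comp3 y i)"
  have pts: "comp3 y i \<in> points F" if "i \<in> {1..3}" for i
    using y[OF that] cdom_subset_points[OF F k[OF that]] by blast
  have k': "?k' i \<in> atlas F" "comp3 y i \<in> cdom (?k' i)" if "i \<in> {1..3}" for i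
    using chart_at_atlas[OF F pts[OF that]] in_cdom_chart_at[OF F pts[OF that]] by auto
  have "form_in_chart (jet_bundle F) (Theta F L l) (jet_chart \<Delta> k) x w =
      partial_L F L l (\<Delta>, y) (coord_change (k l) (?k' l) (comp3 y l) (comp3 w l))"
    using coord_change_jet_chart[where k = k and k' = ?k', OF k k'(1) y k'(2) l]
    by (simp add: form_in_chart_def Theta_def p chart_at_jet_bundle)
  also have "\<dots> = frechet_derivative (local_lagrangian L \<Delta> k)
      (at (cmap (jet_chart \<Delta> k) (\<Delta>, y))) (upd3 0 l (comp3 w l))"
    using partial_L_in_charts[where k = k, OF \<Delta> k y l] .
  also have "cmap (jet_chart \<Delta> k) (\<Delta>, y) = x"
    using f_inv_into_f[OF x] by (simp add: p[symmetric] cinv_def)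
  finally show ?thesis .
qed

end

end

section \<open>The multisymplectic forms in charts\<close>

definition second_derivative :: "('a::real_normed_vector \<Rightarrow> real) \<Rightarrow> 'a \<Rightarrow> 'a \<Rightarrow> 'a \<Rightarrow> real" where
  "second_derivative f x v w = frechet_derivative (\<lambda>y. frechet_derivative f (at y) w) (at x) v"

text \<open>
  Additivity in the argument that is differentiated first comes from the other argument
  by symmetry.
\<close>

lemma second_derivative_sum_right:
  assumes "open S" "x \<in> S" "smooth_on S f"
  shows "(\<Sum>i\<in>I. second_derivative f x v (w i)) = second_derivative f x v (\<Sum>i\<in>I. w i)"
proof -
  have "linear (\<lambda>u. second_derivative f x u v)"
    unfolding second_derivative_def
    using smooth_on_imp_differentiable2[OF assms(3,2)] by (rule linear_frechet_derivative)
  from linear_sum[OF this, of w I] show ?thesis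
    using symmetric_second_derivative[OF assms] by (simp add: second_derivative_def)
qed

text \<open>
  The charts at the three vertices of a triangle that belong to a section; together they form the
  preferred chart of the jet bundle at the jet of this section.
\<close>

definition section_charts :: "('f, 'e) manifold \<Rightarrow> (node \<Rightarrow> 'f) \<Rightarrow> triangle \<Rightarrow> nat \<Rightarrow> ('f, 'e) chart" where
  "section_charts F \<phi> \<Delta> l = chart_at F (\<phi> (comp3 \<Delta> l))"

lemma comp3_jet: "comp3 (snd (jet \<phi> \<Delta>)) l = \<phi> (comp3 \<Delta> l)"
  by (cases \<Delta>) (simp add: jet_def comp3_def)

lemma comp3_jet_ext: "comp3 (jet_ext V (jet \<phi> \<Delta>)) l = V (comp3 \<Delta> l) (\<phi> (comp3 \<Delta> l))"
  by (cases \<Delta>) (simp add: jet_def jet_ext_def comp3_def)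

lemma comp3_in_verts: "l \<in> {1..3} \<Longrightarrow> comp3 \<Delta> l \<in> verts \<Delta>"
  by (simp add: verts_def)

lemma verts_subset_of_touching_interior:
  assumes "x \<in> d_interior U" "\<Delta> \<in> triangles" "l \<in> {1..3}" "comp3 \<Delta> l = x"
  shows "verts \<Delta> \<subseteq> U"
  using assms comp3_in_verts[of l \<Delta>] unfolding d_interior_def by blast

definition jet_hessian ::
    "('f, 'e::real_normed_vector) manifold \<Rightarrow> (triangle \<times> 'f \<times> 'f \<times> 'f \<Rightarrow> real) \<Rightarrow>
     (node \<Rightarrow> 'f) \<Rightarrow> triangle \<Rightarrow> 'e \<times> 'e \<times> 'e \<Rightarrow> 'e \<times> 'e \<times> 'e \<Rightarrow> real" where
  "jet_hessian F L \<phi> \<Delta> =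
     second_derivative (local_lagrangian L \<Delta> (section_charts F \<phi> \<Delta>))
       (cmap (jet_chart \<Delta> (section_charts F \<phi> \<Delta>)) (jet \<phi> \<Delta>))"

context
  fixes F :: "('f, 'e::{banach,heine_borel}) manifold"
    and L :: "triangle \<times> 'f \<times> 'f \<times> 'f \<Rightarrow> real"
  assumes F: "smooth_manifold F" and L: "smooth_function (jet_bundle F) L"
begin

context
  fixes \<phi> :: "node \<Rightarrow> 'f" and \<Delta> :: triangle
  assumes \<Delta>: "\<Delta> \<in> triangles" and \<phi>: "\<And>x. x \<in> verts \<Delta> \<Longrightarrow> \<phi> x \<in> points F"
begin

lemma section_charts_atlas: "l \<in> {1..3} \<Longrightarrow> section_charts F \<phi> \<Delta> l \<in> atlas F"
  and section_charts_cdom: "l \<in> {1..3} \<Longrightarrow> \<phi> (comp3 \<Delta> l) \<in> cdom (section_charts F \<phi> \<Delta> l)"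
  unfolding section_charts_def
  using \<phi>[OF comp3_in_verts] chart_at_atlas[OF F] in_cdom_chart_at[OF F] by auto

lemma open_section_chart_image:
  "open (chart_image (jet_chart \<Delta> (section_charts F \<phi> \<Delta>)))"
  by (rule open_jet_chart_image[OF F section_charts_atlas])

lemma jet_in_section_chart_image:
  "cmap (jet_chart \<Delta> (section_charts F \<phi> \<Delta>)) (jet \<phi> \<Delta>)
     \<in> chart_image (jet_chart \<Delta> (section_charts F \<phi> \<Delta>))"
  using section_charts_cdom[of 1] section_charts_cdom[of 2] section_charts_cdom[of 3]
  by (simp add: jet_def chart_image_jet_chart cmap_jet_chart)

lemma section_local_lagrangian_smooth:
  "smooth_on (chart_image (jet_chart \<Delta> (section_charts F \<phi> \<Delta>)))
     (local_lagrangian L \<Delta> (section_charts F \<phi> \<Delta>))"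
  by (rule local_lagrangian_smooth[OF F L \<Delta> section_charts_atlas])

lemma Omega_in_charts:
  assumes l: "l \<in> {1..3}"
  shows "Omega F L l (jet \<phi> \<Delta>) v w =
           jet_hessian F L \<phi> \<Delta> w (upd3 0 l (comp3 v l)) - jet_hessian F L \<phi> \<Delta> v (upd3 0 l (comp3 w l))"
proof -
  let ?k = "section_charts F \<phi> \<Delta>"
  let ?K = "jet_chart \<Delta> ?k"
  have jet: "jet \<phi> \<Delta> = (\<Delta>, snd (jet \<phi> \<Delta>))" by (simp add: jet_def)
  have "?k = (\<lambda>l. chart_at F (comp3 (snd (jet \<phi> \<Delta>)) l))"
    by (simp add: fun_eq_iff section_charts_def comp3_jet)
  then have K: "chart_at (jet_bundle F) (jet \<phi> \<Delta>) = ?K"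
    by (subst jet) (simp only: chart_at_jet_bundle)
  have "form_in_chart (jet_bundle F) (Theta F L l) ?K x u =
        frechet_derivative (local_lagrangian L \<Delta> ?k) (at x) (upd3 0 l (comp3 u l))"
    if "x \<in> chart_image ?K" for x u
    by (rule Theta_in_jet_chart[OF F L \<Delta> section_charts_atlas that l])
  from frechet_derivative_cong_open[OF open_section_chart_image jet_in_section_chart_image this]
  have "frechet_derivative (\<lambda>x. form_in_chart (jet_bundle F) (Theta F L l) ?K x u)
          (at (cmap ?K (jet \<phi> \<Delta>))) u' = jet_hessian F L \<phi> \<Delta> u' (upd3 0 l (comp3 u l))" for u u'
    unfolding jet_hessian_def second_derivative_def by simp
  then show ?thesis
    by (simp add: Omega_def exterior_derivative_def K Let_def)
qed

text \<open>
  The sum of the forms \<open>\<Theta>\<^sup>l\<close> is \<open>dL\<close>, hence \<open>\<Sum>\<^sub>l \<Omega>\<^sup>l = -d\<^sup>2L\<close>, which vanishes because second derivatives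
  are symmetric.
\<close>

lemma sum_Omega: "(\<Sum>l\<in>{1..3}. Omega F L l (jet \<phi> \<Delta>) v w) = 0"
proof -
  have "(\<Sum>l\<in>{1..3}. jet_hessian F L \<phi> \<Delta> v (upd3 0 l (comp3 w l))) = jet_hessian F L \<phi> \<Delta> v w"
    for v w
    unfolding jet_hessian_def
      second_derivative_sum_right[OF open_section_chart_image jet_in_section_chart_image
        section_local_lagrangian_smooth] sum_upd3_comp3 ..
  moreover have "jet_hessian F L \<phi> \<Delta> v w = jet_hessian F L \<phi> \<Delta> w v"
    unfolding jet_hessian_def second_derivative_def
    by (rule symmetric_second_derivative[OF open_section_chart_image jet_in_section_chart_image
          section_local_lagrangian_smooth])
  ultimately show ?thesis
    by (simp add: Omega_in_charts sum_subtractf)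
qed

end

section \<open>Linearised field equations\<close>

text \<open>
  The field equation at \<open>x\<close> along the flow of \<open>V\<close>, differentiated at time 0. The test
  vector \<open>w\<close> is kept constant in the chart at \<open>\<phi>(x)\<close>; in the moving preferred chart it is the vector
  called \<open>v\<close> in the proof, and the field equation may be tested with it because it holds for all vectors.
\<close>

lemma first_variation_linearised:
  assumes U: "finite U" and \<phi>: "\<phi> \<in> sections F U" and V: "first_variation F L U \<phi> V"
    and x: "x \<in> d_interior U"
  shows "(\<Sum>(\<Delta>, l)\<in>{(\<Delta>, l). \<Delta> \<in> triangles \<and> l \<in> {1..3} \<and> comp3 \<Delta> l = x}.
            jet_hessian F L \<phi> \<Delta> (jet_ext V (jet \<phi> \<Delta>)) (upd3 0 l w)) = 0"
proof -
  let ?A = "{(\<Delta>, l). \<Delta> \<in> triangles \<and> l \<in> {1..3} \<and> comp3 \<Delta> l = x}"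
  have \<phi>U: "\<phi> u \<in> points F" if "u \<in> U" for u
    using \<phi> that by (auto simp: sections_def)
  define P where "P = (\<lambda>u \<delta> \<gamma>. \<delta> > (0::real) \<and> \<gamma> 0 = \<phi> u \<and>
      (\<forall>t. \<bar>t\<bar> < \<delta> \<longrightarrow> \<gamma> t \<in> cdom (chart_at F (\<phi> u)) \<and> flows_to F (V u) t (\<phi> u) (\<gamma> t)) \<and>
      ((\<lambda>t. cmap (chart_at F (\<phi> u)) (\<gamma> t)) has_vector_derivative V u (\<phi> u)) (at 0))"
  have "\<exists>\<delta> \<gamma>. P u \<delta> \<gamma>" if "u \<in> U" for u
  proof -
    have "smooth_vector_field F (V u)" using V unfolding first_variation_def by blast
    from F this \<phi>U[OF that] show ?thesis
    proof (rule local_flow)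
      fix \<delta> \<gamma>
      assume "\<delta> > (0::real)" "\<gamma> 0 = \<phi> u"
        "\<And>t. \<bar>t\<bar> < \<delta> \<Longrightarrow> \<gamma> t \<in> cdom (chart_at F (\<phi> u))"
        "\<And>t. \<bar>t\<bar> < \<delta> \<Longrightarrow> flows_to F (V u) t (\<phi> u) (\<gamma> t)"
        "((\<lambda>t. cmap (chart_at F (\<phi> u)) (\<gamma> t)) has_vector_derivative V u (\<phi> u)) (at 0)"
      then have "P u \<delta> \<gamma>" by (simp add: P_def)
      then show ?thesis by blast
    qed
  qed
  then obtain \<delta> where "\<forall>u\<in>U. \<exists>\<gamma>. P u (\<delta> u) \<gamma>" using bchoice by metis
  from bchoice[OF this] obtain \<gamma> where P: "\<forall>u\<in>U. P u (\<delta> u) (\<gamma> u)" by blast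
  then have \<delta>: "\<And>u. u \<in> U \<Longrightarrow> \<delta> u > 0"
    and \<gamma>0: "\<And>u. u \<in> U \<Longrightarrow> \<gamma> u 0 = \<phi> u"
    and \<gamma>dom: "\<And>u t. u \<in> U \<Longrightarrow> \<bar>t\<bar> < \<delta> u \<Longrightarrow> \<gamma> u t \<in> cdom (chart_at F (\<phi> u))"
    and flow: "\<And>u t. u \<in> U \<Longrightarrow> \<bar>t\<bar> < \<delta> u \<Longrightarrow> flows_to F (V u) t (\<phi> u) (\<gamma> u t)"
    and \<gamma>': "\<And>u. u \<in> U \<Longrightarrow>
      ((\<lambda>t. cmap (chart_at F (\<phi> u)) (\<gamma> u t)) has_vector_derivative V u (\<phi> u)) (at 0)"
    by (simp_all add: P_def)
  \<comment> \<open>A time up to which all the flows exist; here the finiteness of \<open>U\<close> enters.\<close>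
  define d where "d = Min (insert 1 (\<delta> ` U))"
  have d: "d > 0" "\<And>u. u \<in> U \<Longrightarrow> d \<le> \<delta> u"
    using U \<delta> by (auto simp: d_def)
  define \<psi> where "\<psi> = (\<lambda>t. restrict (\<lambda>u. \<gamma> u t) U)"
  let ?k = "section_charts F \<phi>"
  define C where "C = (\<lambda>\<Delta> t. cmap (jet_chart \<Delta> (?k \<Delta>)) (jet (\<psi> t) \<Delta>))"
  define G where "G = (\<lambda>p t. frechet_derivative (local_lagrangian L (fst p) (?k (fst p)))
                              (at (C (fst p) t)) (upd3 0 (snd p) w))"
  have inU: "comp3 \<Delta> i \<in> U" if "(\<Delta>, l) \<in> ?A" "i \<in> {1..3}" for \<Delta> l i
    using verts_subset_of_touching_interior[OF x] that comp3_in_verts[of i \<Delta>] by blast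
  have pts: "\<phi> u \<in> points F" if "(\<Delta>, l) \<in> ?A" "u \<in> verts \<Delta>" for \<Delta> l u
    using verts_subset_of_touching_interior[OF x] that \<phi>U by blast
  have G0: "(\<Sum>p\<in>?A. G p t) = 0" if t: "\<bar>t\<bar> < d" for t
  proof -
    have t\<delta>: "\<bar>t\<bar> < \<delta> u" if "u \<in> U" for u using d(2)[OF that] t by linarith
    have "\<psi> t u \<in> points F" if "u \<in> U" for u
      using \<gamma>dom[OF that t\<delta>[OF that]] cdom_subset_points[OF F chart_at_atlas[OF F \<phi>U[OF that]]] that
      by (auto simp: \<psi>_def)
    then have "\<psi> t \<in> sections F U" by (auto simp: sections_def \<psi>_def)
    moreover have "\<forall>u\<in>U. flows_to F (V u) t (\<phi> u) (\<psi> t u)"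
      using flow t\<delta> by (simp add: \<psi>_def)
    ultimately have sol: "DELF_solution F L U (\<psi> t)"
      using V unfolding first_variation_def by blast
    define v where "v = coord_change (chart_at F (\<phi> x)) (chart_at F (\<psi> t x)) (\<psi> t x) w"
    have "partial_L F L l (jet (\<psi> t) \<Delta>) v = G (\<Delta>, l) t" if \<Delta>l: "(\<Delta>, l) \<in> ?A" for \<Delta> l
    proof -
      have \<Delta>: "\<Delta> \<in> triangles" and l: "l \<in> {1..3}" and xl: "comp3 \<Delta> l = x" using \<Delta>l by auto
      have k: "?k \<Delta> i \<in> atlas F" if "i \<in> {1..3}" for i
        using section_charts_atlas[OF \<Delta> pts[OF \<Delta>l] that] .
      obtain y where y: "jet (\<psi> t) \<Delta> = (\<Delta>, y)" by (simp add: jet_def)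
      have yi: "comp3 y i = \<psi> t (comp3 \<Delta> i)" for i
        using comp3_jet[of "\<psi> t" \<Delta> i] by (simp add: y)
      have dom: "comp3 y i \<in> cdom (?k \<Delta> i)" if "i \<in> {1..3}" for i
        using \<gamma>dom[OF inU[OF \<Delta>l that] t\<delta>[OF inU[OF \<Delta>l that]]] inU[OF \<Delta>l that]
        by (simp add: yi \<psi>_def section_charts_def)
      show ?thesis
        using partial_L_in_charts[where k = "?k \<Delta>" and y = y and w = w, OF F L \<Delta> k dom l]
        by (simp add: G_def C_def y yi xl v_def section_charts_def)
    qed
    then have "(\<Sum>p\<in>?A. G p t) = (\<Sum>(\<Delta>, l)\<in>?A. partial_L F L l (jet (\<psi> t) \<Delta>) v)"
      by (intro sum.cong) auto
    also have "\<dots> = 0" using sol x unfolding DELF_solution_def by blast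
    finally show ?thesis .
  qed
  have G': "((\<lambda>t. G (\<Delta>, l) t) has_vector_derivative
      jet_hessian F L \<phi> \<Delta> (jet_ext V (jet \<phi> \<Delta>)) (upd3 0 l w)) (at 0)" if \<Delta>l: "(\<Delta>, l) \<in> ?A" for \<Delta> l
  proof -
    have \<Delta>: "\<Delta> \<in> triangles" using \<Delta>l by auto
    have U3: "comp3 \<Delta> 1 \<in> U" "comp3 \<Delta> 2 \<in> U" "comp3 \<Delta> 3 \<in> U" using inU[OF \<Delta>l] by auto
    have "((\<lambda>t. (cmap (?k \<Delta> 1) (\<gamma> (comp3 \<Delta> 1) t), cmap (?k \<Delta> 2) (\<gamma> (comp3 \<Delta> 2) t),
                 cmap (?k \<Delta> 3) (\<gamma> (comp3 \<Delta> 3) t))) has_vector_derivative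
        (V (comp3 \<Delta> 1) (\<phi> (comp3 \<Delta> 1)), V (comp3 \<Delta> 2) (\<phi> (comp3 \<Delta> 2)),
         V (comp3 \<Delta> 3) (\<phi> (comp3 \<Delta> 3)))) (at 0)"
      unfolding section_charts_def by (intro has_vector_derivative_Pair \<gamma>' U3)
    moreover have "C \<Delta> = (\<lambda>t. (cmap (?k \<Delta> 1) (\<gamma> (comp3 \<Delta> 1) t), cmap (?k \<Delta> 2) (\<gamma> (comp3 \<Delta> 2) t),
                 cmap (?k \<Delta> 3) (\<gamma> (comp3 \<Delta> 3) t)))"
      using U3 by (simp add: C_def jet_def cmap_jet_chart \<psi>_def)
    moreover have "jet_ext V (jet \<phi> \<Delta>) = (V (comp3 \<Delta> 1) (\<phi> (comp3 \<Delta> 1)),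
         V (comp3 \<Delta> 2) (\<phi> (comp3 \<Delta> 2)), V (comp3 \<Delta> 3) (\<phi> (comp3 \<Delta> 3)))"
      by (simp add: jet_ext_def jet_def)
    ultimately have C': "(C \<Delta> has_vector_derivative jet_ext V (jet \<phi> \<Delta>)) (at 0)"
      by simp
    have C0: "C \<Delta> 0 = cmap (jet_chart \<Delta> (?k \<Delta>)) (jet \<phi> \<Delta>)"
      using U3 \<gamma>0 by (simp add: C_def jet_def \<psi>_def)
    let ?g = "\<lambda>y. frechet_derivative (local_lagrangian L \<Delta> (?k \<Delta>)) (at y) (upd3 0 l w)"
    have "?g differentiable (at (C \<Delta> 0))"
      unfolding C0
      using smooth_on_imp_differentiable2[OF section_local_lagrangian_smooth[OF \<Delta> pts[OF \<Delta>l]]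
        jet_in_section_chart_image[OF \<Delta> pts[OF \<Delta>l]]] .
    then have "(?g has_derivative (\<lambda>v. jet_hessian F L \<phi> \<Delta> v (upd3 0 l w))) (at (C \<Delta> 0) within range (C \<Delta>))"
      unfolding frechet_derivative_works jet_hessian_def second_derivative_def C0
      by (rule has_derivative_at_withinI)
    from vector_derivative_diff_chain_within[OF C' this] show ?thesis
      by (simp add: G_def o_def)
  qed
  have "((\<lambda>t. \<Sum>p\<in>?A. G p t) has_vector_derivative
      (\<Sum>(\<Delta>, l)\<in>?A. jet_hessian F L \<phi> \<Delta> (jet_ext V (jet \<phi> \<Delta>)) (upd3 0 l w))) (at 0)"
    using G' by (intro has_vector_derivative_sum) auto
  moreover have "((\<lambda>t. \<Sum>p\<in>?A. G p t) has_vector_derivative 0) (at 0)"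
    using d G0
    by (intro has_vector_derivative_transform_within_open[OF has_vector_derivative_const
          open_greaterThanLessThan[of "-d" d]]) auto
  ultimately show ?thesis
    by (rule vector_derivative_unique_at)
qed

text \<open>
  The terms of \<open>\<Omega>\<^sup>l\<close> are those of the field equation linearised along \<open>V\<close> and tested with \<open>W\<close>, minus those with
  \<open>V\<close> and \<open>W\<close> exchanged.
\<close>

lemma sum_Omega_at_interior:
  assumes U: "finite U" and \<phi>: "\<phi> \<in> sections F U"
    and V: "first_variation F L U \<phi> V" and W: "first_variation F L U \<phi> W"
    and x: "x \<in> d_interior U"
  shows "(\<Sum>(\<Delta>, l)\<in>{(\<Delta>, l). \<Delta> \<in> triangles \<and> l \<in> {1..3} \<and> comp3 \<Delta> l = x}.
            Omega F L l (jet \<phi> \<Delta>) (jet_ext W (jet \<phi> \<Delta>)) (jet_ext V (jet \<phi> \<Delta>))) = 0"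
    (is "(\<Sum>(\<Delta>, l)\<in>?A. ?\<omega> \<Delta> l) = 0")
proof -
  have "?\<omega> \<Delta> l = jet_hessian F L \<phi> \<Delta> (jet_ext V (jet \<phi> \<Delta>)) (upd3 0 l (W x (\<phi> x)))
                - jet_hessian F L \<phi> \<Delta> (jet_ext W (jet \<phi> \<Delta>)) (upd3 0 l (V x (\<phi> x)))"
    if "(\<Delta>, l) \<in> ?A" for \<Delta> l
  proof -
    have "\<phi> u \<in> points F" if "u \<in> verts \<Delta>" for u
      using verts_subset_of_touching_interior[OF x, of \<Delta> l] \<open>(\<Delta>, l) \<in> ?A\<close> that \<phi>
      by (auto simp: sections_def)
    from Omega_in_charts[of \<Delta> \<phi> l, OF _ this] show ?thesis
      using that by (auto simp: comp3_jet_ext)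
  qed
  then have "(\<Sum>(\<Delta>, l)\<in>?A. ?\<omega> \<Delta> l) =
      (\<Sum>(\<Delta>, l)\<in>?A. jet_hessian F L \<phi> \<Delta> (jet_ext V (jet \<phi> \<Delta>)) (upd3 0 l (W x (\<phi> x)))
                  - jet_hessian F L \<phi> \<Delta> (jet_ext W (jet \<phi> \<Delta>)) (upd3 0 l (V x (\<phi> x))))"
    by (intro sum.cong) auto
  then show ?thesis
    using first_variation_linearised[OF U \<phi> V x] first_variation_linearised[OF U \<phi> W x]
    by (simp add: case_prod_unfold sum_subtractf)
qed

end

section \<open>The multisymplectic form formula\<close>

theorem mainTheorem5:
  fixes F :: "('f, 'e::{banach,heine_borel}) manifold"
    and L :: "triangle \<times> 'f \<times> 'f \<times> 'f \<Rightarrow> real"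
    and U :: "node set"
    and \<phi> :: "node \<Rightarrow> 'f"
    and V W :: "node \<Rightarrow> 'f \<Rightarrow> 'e"
  assumes "smooth_manifold F"
    and "smooth_function (jet_bundle F) L"
    and "finite U" and "d_regular U"
    and "DELF_solution F L U \<phi>"
    and "first_variation F L U \<phi> V"
    and "first_variation F L U \<phi> W"
  shows "(\<Sum>\<Delta> | \<Delta> \<in> triangles \<and> verts \<Delta> \<subseteq> U \<and> verts \<Delta> \<inter> d_boundary U \<noteq> {}.
           \<Sum>l | l \<in> {1..3} \<and> comp3 \<Delta> l \<in> d_boundary U.
             jet_pullback \<phi> (jet_ext V \<lrcorner> jet_ext W \<lrcorner> Omega F L l) \<Delta>) = 0"
proof -
  define \<omega> where "\<omega> = (\<lambda>\<Delta> l. Omega F L l (jet \<phi> \<Delta>) (jet_ext W (jet \<phi> \<Delta>)) (jet_ext V (jet \<phi> \<Delta>)))"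
  define T where "T = {\<Delta> \<in> triangles. verts \<Delta> \<subseteq> U}"
  define I where "I = (\<lambda>\<Delta>. {l \<in> {1..3}. comp3 \<Delta> l \<in> d_interior U})"
  define B where "B = (\<lambda>\<Delta>. {l \<in> {1..3}. comp3 \<Delta> l \<in> d_boundary U})"
  have \<phi>: "\<phi> \<in> sections F U" using assms(5) by (simp add: DELF_solution_def)
  have finT: "finite T"
  proof (rule finite_subset)
    show "T \<subseteq> U \<times> U \<times> U"
    proof
      fix \<Delta> assume "\<Delta> \<in> T"
      then have "comp3 \<Delta> l \<in> U" if "l \<in> {1..3}" for l
        using comp3_in_verts[OF that, of \<Delta>] by (auto simp: T_def)
      from this[of 1] this[of 2] this[of 3] show "\<Delta> \<in> U \<times> U \<times> U"
        by (cases \<Delta>) (simp add: comp3_def)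
    qed
  qed (use assms(3) in simp)
  have split: "(\<Sum>l\<in>I \<Delta>. \<omega> \<Delta> l) + (\<Sum>l\<in>B \<Delta>. \<omega> \<Delta> l) = 0" if "\<Delta> \<in> T" for \<Delta>
  proof -
    have "comp3 \<Delta> l \<in> U" if "l \<in> {1..3}" for l
      using \<open>\<Delta> \<in> T\<close> comp3_in_verts[OF that, of \<Delta>] by (auto simp: T_def)
    then have "I \<Delta> \<union> B \<Delta> = {1..3}" "I \<Delta> \<inter> B \<Delta> = {}"
      using assms(4) by (auto simp: I_def B_def d_regular_def d_boundary_def)
    then have "(\<Sum>l\<in>I \<Delta>. \<omega> \<Delta> l) + (\<Sum>l\<in>B \<Delta>. \<omega> \<Delta> l) = (\<Sum>l\<in>{1..3}. \<omega> \<Delta> l)"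
      by (metis finite_Un finite_atLeastAtMost sum.union_disjoint)
    also have "\<dots> = 0"
      unfolding \<omega>_def using \<open>\<Delta> \<in> T\<close> \<phi>
      by (intro sum_Omega[OF assms(1,2)]) (auto simp: T_def sections_def)
    finally show ?thesis .
  qed
  \<comment> \<open>The interior part is regrouped by vertices instead of triangles.\<close>
  have "(\<Sum>\<Delta>\<in>T. \<Sum>l\<in>I \<Delta>. \<omega> \<Delta> l) = (\<Sum>(\<Delta>, l)\<in>Sigma T I. \<omega> \<Delta> l)"
    using finT by (intro sum.Sigma) (auto simp: I_def)
  also have "\<dots> = (\<Sum>x\<in>d_interior U. \<Sum>(\<Delta>, l)\<in>{p \<in> Sigma T I. (\<lambda>(\<Delta>, l). comp3 \<Delta> l) p = x}. \<omega> \<Delta> l)"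
    using finT assms(3)
    by (intro sum.group[symmetric]) (auto simp: I_def d_interior_def)
  also have "\<dots> = (\<Sum>x\<in>d_interior U. 0)"
  proof (rule sum.cong[OF refl])
    fix x assume x: "x \<in> d_interior U"
    have "{p \<in> Sigma T I. (\<lambda>(\<Delta>, l). comp3 \<Delta> l) p = x} =
        {(\<Delta>, l). \<Delta> \<in> triangles \<and> l \<in> {1..3} \<and> comp3 \<Delta> l = x}"
    proof (rule set_eqI)
      fix p :: "triangle \<times> nat"
      obtain \<Delta> l where p: "p = (\<Delta>, l)" by (cases p)
      show "p \<in> {p \<in> Sigma T I. (\<lambda>(\<Delta>, l). comp3 \<Delta> l) p = x} \<longleftrightarrow>
            p \<in> {(\<Delta>, l). \<Delta> \<in> triangles \<and> l \<in> {1..3} \<and> comp3 \<Delta> l = x}"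
        unfolding p using x verts_subset_of_touching_interior[OF x, of \<Delta> l]
        by (simp add: T_def I_def) blast
    qed
    then show "(\<Sum>(\<Delta>, l)\<in>{p \<in> Sigma T I. (\<lambda>(\<Delta>, l). comp3 \<Delta> l) p = x}. \<omega> \<Delta> l) = 0"
      using sum_Omega_at_interior[OF assms(1,2,3) \<phi> assms(6,7) x] by (simp add: \<omega>_def)
  qed
  finally have interior: "(\<Sum>\<Delta>\<in>T. \<Sum>l\<in>I \<Delta>. \<omega> \<Delta> l) = 0" by simp
  have "(\<Sum>\<Delta> | \<Delta> \<in> triangles \<and> verts \<Delta> \<subseteq> U \<and> verts \<Delta> \<inter> d_boundary U \<noteq> {}.
           \<Sum>l | l \<in> {1..3} \<and> comp3 \<Delta> l \<in> d_boundary U.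
             jet_pullback \<phi> (jet_ext V \<lrcorner> jet_ext W \<lrcorner> Omega F L l) \<Delta>) =
        (\<Sum>\<Delta> | \<Delta> \<in> triangles \<and> verts \<Delta> \<subseteq> U \<and> verts \<Delta> \<inter> d_boundary U \<noteq> {}. \<Sum>l\<in>B \<Delta>. \<omega> \<Delta> l)"
    by (simp add: jet_pullback_def interior_product_def \<omega>_def B_def)
  \<comment> \<open>Triangles without boundary vertices contribute empty sums.\<close>
  also have "\<dots> = (\<Sum>\<Delta>\<in>T. \<Sum>l\<in>B \<Delta>. \<omega> \<Delta> l)"
  proof (rule sum.mono_neutral_left[OF finT])
    show "\<forall>\<Delta>\<in>T - {\<Delta>. \<Delta> \<in> triangles \<and> verts \<Delta> \<subseteq> U \<and> verts \<Delta> \<inter> d_boundary U \<noteq> {}}. (\<Sum>l\<in>B \<Delta>. \<omega> \<Delta> l) = 0"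
    proof
      fix \<Delta> assume "\<Delta> \<in> T - {\<Delta>. \<Delta> \<in> triangles \<and> verts \<Delta> \<subseteq> U \<and> verts \<Delta> \<inter> d_boundary U \<noteq> {}}"
      then have "B \<Delta> = {}" using comp3_in_verts[of _ \<Delta>] by (auto simp: T_def B_def)
      then show "(\<Sum>l\<in>B \<Delta>. \<omega> \<Delta> l) = 0" by simp
    qed
  qed (auto simp: T_def)
  also have "\<dots> = (\<Sum>\<Delta>\<in>T. \<Sum>l\<in>I \<Delta>. \<omega> \<Delta> l) + (\<Sum>\<Delta>\<in>T. \<Sum>l\<in>B \<Delta>. \<omega> \<Delta> l)"
    using interior by simp
  also have "\<dots> = (\<Sum>\<Delta>\<in>T. (\<Sum>l\<in>I \<Delta>. \<omega> \<Delta> l) + (\<Sum>l\<in>B \<Delta>. \<omega> \<Delta> l))"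
    by (rule sum.distrib[symmetric])
  also have "\<dots> = 0"
    using split by simp
  finally show ?thesis .
qed

end
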